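(* The set ${\rm Prim}(D(R_A))=\{{\rm Ann}(L(\boldsymbol\alpha)):\boldsymbol\alpha\in\mathbb C^d\}$ is finite.
   Context: $A\subset\mathbb Z^d$ is a finite set generating the group $\mathbb Z^d$; $R_A=\mathbb C[\mathbb NA]\subseteq\mathbb C[t_1^{\pm1},\dots,t_d^{\pm1}]$; $D(R_A)=\{P\in\mathbb C[t^{\pm1}]\langle\partial_1,\dots,\partial_d\rangle:P(R_A)\subseteq R_A\}$; $s_j=t_j\partial_j$. $M(\boldsymbol\alpha)=D(R_A)/\sum_iD(R_A)(s_i-\alpha_i)$ has, in the category of left $D(R_A)$-modules that are direct sums of finite-dimensional weight spaces $\{x:f(s)x=f(\boldsymbol\lambda)x\ \forall f\in\mathbb C[s]\}$, a unique simple quotient $L(\boldsymbol\alpha)$; ${\rm Ann}$ denotes the annihilator ideal in $D(R_A)$. *)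

theory Defs
  imports "HOL-Analysis.Analysis"
begin

text \<open>Laurent series / polynomials in t_1..t_d are represented by their coefficient
functions (exponent vector u in Z^d maps to the coefficient of t^u).  Differential
operators are represented by their (faithful) action on such coefficient functions.\<close>

type_synonym 'd coeffs = "(int ^ 'd) \<Rightarrow> complex"
type_synonym 'd dop = "'d coeffs \<Rightarrow> 'd coeffs"

definition unitv :: "'d::finite \<Rightarrow> int ^ 'd" where
  "unitv i = (\<chi> j. if j = i then 1 else 0)"

definition mul_t :: "'d::finite \<Rightarrow> 'd dop" where
  "mul_t i f = (\<lambda>v. f (v - unitv i))"
definition mul_tinv :: "'d::finite \<Rightarrow> 'd dop" where
  "mul_tinv i f = (\<lambda>v. f (v + unitv i))"
definition partial :: "'d::finite \<Rightarrow> 'd dop" where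
  "partial i f = (\<lambda>v. of_int (v $ i + 1) * f (v + unitv i))"

definition op_add :: "'d dop \<Rightarrow> 'd dop \<Rightarrow> 'd dop" where
  "op_add P Q = (\<lambda>f v. P f v + Q f v)"
definition op_scal :: "complex \<Rightarrow> 'd dop" where
  "op_scal c = (\<lambda>f v. c * f v)"

inductive_set weyl_laurent :: "('d::finite) dop set" where
  scal: "op_scal c \<in> weyl_laurent"
| tt: "mul_t i \<in> weyl_laurent"
| ttinv: "mul_tinv i \<in> weyl_laurent"
| dd: "partial i \<in> weyl_laurent"
| add: "P \<in> weyl_laurent \<Longrightarrow> Q \<in> weyl_laurent \<Longrightarrow> op_add P Q \<in> weyl_laurent"
| comp: "P \<in> weyl_laurent \<Longrightarrow> Q \<in> weyl_laurent \<Longrightarrow> P \<circ> Q \<in> weyl_laurent"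

definition semigroupNA :: "(int ^ 'd) set \<Rightarrow> (int ^ 'd) set" where
  "semigroupNA A = {x. \<exists>n :: int ^ 'd \<Rightarrow> nat. x = (\<Sum>a\<in>A. (\<chi> j. int (n a) * a $ j))}"

definition group_generated :: "(int ^ 'd) set \<Rightarrow> (int ^ 'd) set" where
  "group_generated A = {x. \<exists>k :: int ^ 'd \<Rightarrow> int. x = (\<Sum>a\<in>A. (\<chi> j. k a * a $ j))}"

definition RA :: "(int ^ 'd) set \<Rightarrow> 'd coeffs set" where
  "RA A = {f. finite {u. f u \<noteq> 0} \<and> {u. f u \<noteq> 0} \<subseteq> semigroupNA A}"

definition DRA :: "(int ^ ('d::finite)) set \<Rightarrow> 'd dop set" where
  "DRA A = {P \<in> weyl_laurent. \<forall>f \<in> RA A. P f \<in> RA A}"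

definition euler :: "'d::finite \<Rightarrow> 'd dop" where
  "euler j = mul_t j \<circ> partial j"

definition left_ideal :: "'d dop set \<Rightarrow> 'd dop set \<Rightarrow> bool" where
  "left_ideal D I \<longleftrightarrow> I \<subseteq> D \<and> op_scal 0 \<in> I \<and>
     (\<forall>P\<in>I. \<forall>Q\<in>I. op_add P Q \<in> I) \<and> (\<forall>Q\<in>D. \<forall>P\<in>I. Q \<circ> P \<in> I)"

text \<open>The left ideal sum_i D(R_A)(s_i - alpha_i), so that M(alpha) = D(R_A)/Kideal\<close>
definition Kideal :: "(int ^ ('d::finite)) set \<Rightarrow> complex ^ 'd \<Rightarrow> 'd dop set" where
  "Kideal A \<alpha> = {(\<lambda>f v. \<Sum>i\<in>UNIV. (Q i \<circ> op_add (euler i) (op_scal (- \<alpha> $ i))) f v) | Q.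
      \<forall>i. Q i \<in> DRA A}"

text \<open>Preimage in D(R_A) of the unique maximal proper submodule of M(alpha), so that
  L(alpha) = D(R_A)/Jideal\<close>
definition Jideal :: "(int ^ ('d::finite)) set \<Rightarrow> complex ^ 'd \<Rightarrow> 'd dop set" where
  "Jideal A \<alpha> = (THE J. left_ideal (DRA A) J \<and> Kideal A \<alpha> \<subseteq> J \<and> J \<noteq> DRA A \<and>
      (\<forall>I. left_ideal (DRA A) I \<and> Kideal A \<alpha> \<subseteq> I \<and> I \<noteq> DRA A \<longrightarrow> I \<subseteq> J))"

definition AnnL :: "(int ^ ('d::finite)) set \<Rightarrow> complex ^ 'd \<Rightarrow> 'd dop set" where
  "AnnL A \<alpha> = {P \<in> DRA A. \<forall>Q \<in> DRA A. P \<circ> Q \<in> Jideal A \<alpha>}"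

end

theory Submission
  imports Defs
begin

text \<open>Write \<open>S = \<nat>A\<close>. An element of \<open>D(R\<^sub>A)\<close> is a finite sum of \<open>t\<^sup>a p\<^sub>a(s)\<close> with \<open>p\<^sub>a\<close> a polynomial
  vanishing on \<open>{u \<in> S. u + a \<notin> S}\<close>. Say that \<open>\<alpha>\<close> reaches \<open>\<alpha> + a\<close> if some such \<open>p\<^sub>a\<close> is nonzero
  at \<open>\<alpha>\<close>. The annihilator of \<open>L(\<alpha>)\<close> consists of the sums in which each \<open>p\<^sub>a\<close> vanishes at all
  \<open>\<beta>\<close> reached from \<open>\<alpha>\<close> for which \<open>\<beta> + a\<close> reaches \<open>\<alpha>\<close>.

  For \<open>F \<subseteq> A\<close> let \<open>E\<^sub>F(\<alpha>)\<close> be the set of \<open>x \<in> \<complex>F\<close> with \<open>\<alpha> - x \<in> S + \<int>F\<close>. Then \<open>\<alpha>\<close> reaches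
  \<open>\<beta> \<in> \<alpha> + \<int>\<^sup>d\<close> if and only if \<open>E\<^sub>F(\<alpha>) \<subseteq> E\<^sub>F(\<beta>)\<close> for all \<open>F \<subseteq> A\<close>. Only the \<open>F\<close> with
  \<open>\<alpha> \<in> \<complex>F + \<int>\<^sup>d\<close> matter; let \<open>V\<close> be the intersection of their spans \<open>\<complex>F\<close>. The set of relevant
  \<open>\<beta>\<close> is invariant under the intersection of the lattices \<open>\<int>F\<close>, which spans \<open>V\<close> over \<open>\<complex>\<close>, so
  the polynomials vanishing on it do not change when \<open>\<alpha>\<close> is translated by \<open>V\<close>. Modulo this
  translation and \<open>\<int>\<^sup>d\<close> only finitely many families \<open>E\<^sub>F\<close> remain.\<close>

subsection \<open>Polynomial functions\<close>

definition cvec :: "int ^ 'd \<Rightarrow> complex ^ ('d::finite)" where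
  "cvec u = (\<chi> i. of_int (u $ i))"

lemma cvec_nth [simp]: "cvec u $ i = of_int (u $ i)"
  by (simp add: cvec_def)

lemma cvec_add: "cvec (u + v) = cvec u + cvec v"
  and cvec_diff: "cvec (u - v) = cvec u - cvec v"
  and cvec_minus: "cvec (- u) = - cvec u"
  and cvec_zero [simp]: "cvec 0 = 0"
  and cvec_scale: "cvec (k *s u) = of_int k *s cvec u"
  by (simp_all add: vec_eq_iff)

lemma cvec_sum: "cvec (\<Sum>a\<in>S. g a) = (\<Sum>a\<in>S. cvec (g a))"
  by (induction S rule: infinite_finite_induct) (auto simp: cvec_add)

lemma cvec_eq_iff [simp]: "cvec u = cvec v \<longleftrightarrow> u = v"
  by (simp add: vec_eq_iff)

inductive_set polyf :: "(complex ^ ('d::finite) \<Rightarrow> complex) set" where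
  const: "(\<lambda>_. c) \<in> polyf"
| coord: "(\<lambda>x. x $ i) \<in> polyf"
| add: "p \<in> polyf \<Longrightarrow> q \<in> polyf \<Longrightarrow> (\<lambda>x. p x + q x) \<in> polyf"
| mult: "p \<in> polyf \<Longrightarrow> q \<in> polyf \<Longrightarrow> (\<lambda>x. p x * q x) \<in> polyf"

lemma polyf_diff: "p \<in> polyf \<Longrightarrow> q \<in> polyf \<Longrightarrow> (\<lambda>x. p x - q x) \<in> polyf"
  using polyf.add[OF _ polyf.mult[OF polyf.const[of "-1"]], of p q] by simp

lemma polyf_cmult: "p \<in> polyf \<Longrightarrow> (\<lambda>x. c * p x) \<in> polyf"
  using polyf.mult[OF polyf.const] .

lemma polyf_sum: "(\<And>i. i \<in> I \<Longrightarrow> p i \<in> polyf) \<Longrightarrow> (\<lambda>x. \<Sum>i\<in>I. p i x) \<in> polyf"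
  by (induction I rule: infinite_finite_induct) (auto intro: polyf.intros)

lemma polyf_prod: "(\<And>i. i \<in> I \<Longrightarrow> p i \<in> polyf) \<Longrightarrow> (\<lambda>x. \<Prod>i\<in>I. p i x) \<in> polyf"
  by (induction I rule: infinite_finite_induct) (auto intro: polyf.intros)

lemma polyf_translate: "p \<in> polyf \<Longrightarrow> (\<lambda>x. p (x + y)) \<in> polyf"
proof (induction rule: polyf.induct)
  case (coord i)
  show ?case using polyf.add[OF polyf.coord polyf.const] by simp
qed (auto intro: polyf.intros)

section \<open>Restriction to lines and Zariski density of lattice points\<close>

lemma polyf_on_line:
  assumes "p \<in> polyf"
  shows "\<exists>r. \<forall>t. p (x + t *s w) = poly r t"
  using assms
proof (induction rule: polyf.induct)
  case (const c)
  show ?case by (rule exI[of _ "[:c:]"]) simp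
next
  case (coord i)
  show ?case by (rule exI[of _ "[:x $ i, w $ i:]"]) simp
next
  case (add p q)
  then obtain r s where "\<forall>t. p (x + t *s w) = poly r t" "\<forall>t. q (x + t *s w) = poly s t"
    by blast
  then show ?case by (intro exI[of _ "r + s"]) simp
next
  case (mult p q)
  then obtain r s where "\<forall>t. p (x + t *s w) = poly r t" "\<forall>t. q (x + t *s w) = poly s t"
    by blast
  then show ?case by (intro exI[of _ "r * s"]) simp
qed

text \<open>On a line in direction \<open>w j\<close> the polynomial is univariate and has all
  natural numbers as roots, hence is zero; induction frees one direction at a time. So a cone of
  lattice points is Zariski dense in the affine space it spans.\<close>

lemma polyf_zero_on_lattice:
  assumes "finite J" "p \<in> polyf"
    and "\<And>n :: 'j \<Rightarrow> nat. p (x + (\<Sum>j\<in>J. of_nat (n j) *s w j)) = 0"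
  shows "p (x + (\<Sum>j\<in>J. c j *s w j)) = 0"
  using assms(1,3)
proof (induction J arbitrary: x rule: finite_induct)
  case empty
  then show ?case by simp
next
  case (insert j J)
  define y where "y = x + (\<Sum>i\<in>J. c i *s w i)"
  have *: "p (y + of_nat m *s w j) = 0" for m
  proof -
    have "p (x + of_nat m *s w j + (\<Sum>i\<in>J. of_nat (n i) *s w i)) = 0" for n :: "'j \<Rightarrow> nat"
    proof -
      have "(\<Sum>i\<in>J. of_nat ((n(j := m)) i) *s w i) = (\<Sum>i\<in>J. of_nat (n i) *s w i :: complex ^ 'a)"
        using insert.hyps by (intro sum.cong) auto
      then show ?thesis
        using insert.prems[of "n(j := m)"] insert.hyps by (simp add: add.assoc)
    qed
    from insert.IH[OF this] show ?thesis
      by (simp add: y_def algebra_simps)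
  qed
  obtain r where r: "\<And>t. p (y + t *s w j) = poly r t"
    using polyf_on_line[OF assms(2)] by blast
  have "range (of_nat :: nat \<Rightarrow> complex) \<subseteq> {t. poly r t = 0}"
    using * r by auto
  moreover have "infinite (range (of_nat :: nat \<Rightarrow> complex))"
    using finite_imageD inj_of_nat by blast
  ultimately have "r = 0"
    using poly_roots_finite finite_subset by blast
  then have "p (y + c j *s w j) = 0"
    by (simp add: r)
  then show ?case
    using insert.hyps by (simp add: y_def algebra_simps)
qed

lemma vec_eq_sum_axis: "(\<Sum>j\<in>UNIV. (x $ j) *s axis j 1) = (x :: complex ^ 'd::finite)"
  using basis_expansion[of x] by simp

lemma polyf_eq_zero:
  assumes "p \<in> polyf" "\<And>u. p (cvec u) = 0"
  shows "p x = 0"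
proof -
  have "p (0 + (\<Sum>j\<in>UNIV. (x $ j) *s axis j 1)) = 0"
  proof (rule polyf_zero_on_lattice[OF finite assms(1)])
    fix n :: "'a \<Rightarrow> nat"
    have "0 + (\<Sum>j\<in>UNIV. of_nat (n j) *s axis j 1) = cvec (\<chi> j. int (n j))"
      using vec_eq_sum_axis[of "cvec (\<chi> j. int (n j))"] by simp
    then show "p (0 + (\<Sum>j\<in>UNIV. of_nat (n j) *s axis j 1)) = 0"
      by (simp add: assms(2))
  qed
  then show ?thesis by (simp add: vec_eq_sum_axis)
qed

lemma polyf_eqI:
  assumes "p \<in> polyf" "q \<in> polyf" "\<And>u. p (cvec u) = q (cvec u)"
  shows "p = q"
proof
  fix x
  show "p x = q x"
    using polyf_eq_zero[OF polyf_diff[OF assms(1,2)], of x] assms(3) by simp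
qed

text \<open>Division by the maximal ideal of the point \<open>\<alpha>\<close>; products use
  \<open>p q - p(\<alpha>) q(\<alpha>) = (p - p(\<alpha>)) q + p(\<alpha>) (q -
  q(\<alpha>))\<close>. It serves to produce members of \<open>Kideal\<close>.\<close>

lemma polyf_remainder:
  assumes "p \<in> polyf"
  shows "\<exists>h. (\<forall>i. h i \<in> polyf) \<and> (\<forall>x. p x = p \<alpha> + (\<Sum>i\<in>UNIV. h i x * (x $ i - \<alpha> $ i)))"
  using assms
proof (induction rule: polyf.induct)
  case (const c)
  show ?case by (rule exI[of _ "\<lambda>_ _. 0"]) (auto intro: polyf.intros)
next
  case (coord j)
  have "(\<Sum>i\<in>UNIV. (if i = j then 1 else 0) * (x $ i - \<alpha> $ i)) = x $ j - \<alpha> $ j" for x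
    by (simp add: if_distrib[of "\<lambda>y. y * _"] cong: if_cong)
  then show ?case
    by (intro exI[of _ "\<lambda>i _. if i = j then 1 else 0"]) (auto intro: polyf.intros)
next
  case (add p q)
  then obtain h k where pol: "\<And>i. h i \<in> polyf" "\<And>i. k i \<in> polyf"
    and hk: "\<And>x. p x = p \<alpha> + (\<Sum>i\<in>UNIV. h i x * (x $ i - \<alpha> $ i))"
      "\<And>x. q x = q \<alpha> + (\<Sum>i\<in>UNIV. k i x * (x $ i - \<alpha> $ i))"
    by blast
  have "p x + q x = p \<alpha> + q \<alpha> + (\<Sum>i\<in>UNIV. (h i x + k i x) * (x $ i - \<alpha> $ i))" for x
    unfolding distrib_right sum.distrib using arg_cong2[OF hk(1)[of x] hk(2)[of x], of "(+)"] by (simp only: ac_simps)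
  moreover have "(\<lambda>x. h i x + k i x) \<in> polyf" for i
    by (intro polyf.intros pol)
  ultimately show ?case
    by (intro exI[of _ "\<lambda>i x. h i x + k i x"] conjI allI)
next
  case (mult p q)
  then obtain h k where pol: "\<And>i. h i \<in> polyf" "\<And>i. k i \<in> polyf"
    and hk: "\<And>x. p x = p \<alpha> + (\<Sum>i\<in>UNIV. h i x * (x $ i - \<alpha> $ i))"
      "\<And>x. q x = q \<alpha> + (\<Sum>i\<in>UNIV. k i x * (x $ i - \<alpha> $ i))"
    by blast
  have "p x * q x = p \<alpha> * q \<alpha> + (\<Sum>i\<in>UNIV. (h i x * q x + p \<alpha> * k i x) * (x $ i - \<alpha> $ i))" for x
  proof -
    have "p x - p \<alpha> = (\<Sum>i\<in>UNIV. h i x * (x $ i - \<alpha> $ i))"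
      using hk(1)[of x] by (metis add_diff_cancel_left')
    then have 1: "(p x - p \<alpha>) * q x = (\<Sum>i\<in>UNIV. h i x * q x * (x $ i - \<alpha> $ i))"
      by (simp add: sum_distrib_right mult.assoc mult.commute[of "q x"])
    have "q x - q \<alpha> = (\<Sum>i\<in>UNIV. k i x * (x $ i - \<alpha> $ i))"
      using hk(2)[of x] by (metis add_diff_cancel_left')
    then have 2: "p \<alpha> * (q x - q \<alpha>) = (\<Sum>i\<in>UNIV. p \<alpha> * k i x * (x $ i - \<alpha> $ i))"
      by (simp add: sum_distrib_left mult.assoc)
    have "p x * q x = p \<alpha> * q \<alpha> + ((p x - p \<alpha>) * q x + p \<alpha> * (q x - q \<alpha>))"
      by (simp add: algebra_simps)
    then show ?thesis
      unfolding 1 2 by (simp add: sum.distrib distrib_right)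
  qed
  moreover have "(\<lambda>x. h i x * q x + p \<alpha> * k i x) \<in> polyf" for i
    by (intro polyf.add polyf.mult polyf.const pol mult.hyps)
  ultimately show ?case
    by (intro exI[of _ "\<lambda>i x. h i x * q x + p \<alpha> * k i x"] conjI allI)
qed

text \<open>One affine factor for each \<open>a\<close>, taken in a coordinate where
  \<open>a\<close> is nonzero. As a polynomial in the Euler operators, \<open>g\<close> isolates the
  weight \<open>\<alpha>\<close> among finitely many weights.\<close>

lemma polyf_separating_points:
  assumes "finite K" "0 \<notin> K"
  shows "\<exists>g\<in>polyf. g \<alpha> = 1 \<and> (\<forall>a\<in>K. g (\<alpha> + cvec a) = 0)"
  using assms
proof (induction K rule: finite_induct)
  case empty
  show ?case by (rule bexI[of _ "\<lambda>_. 1"]) (auto intro: polyf.intros)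
next
  case (insert a K)
  then obtain g where g: "g \<in> polyf" "g \<alpha> = 1" "\<forall>a\<in>K. g (\<alpha> + cvec a) = 0" by auto
  obtain j where j: "a $ j \<noteq> 0"
    using insert.prems by (auto simp: vec_eq_iff)
  define h where "h = (\<lambda>x. (- 1 / of_int (a $ j)) * (x $ j - (\<alpha> $ j + of_int (a $ j))))"
  have "h \<in> polyf"
    unfolding h_def by (intro polyf_cmult polyf_diff polyf.intros)
  moreover have "h \<alpha> = 1" "h (\<alpha> + cvec a) = 0"
    using j by (auto simp: h_def field_simps)
  ultimately show ?case
    using g by (intro bexI[of _ "\<lambda>x. h x * g x"]) (auto intro: polyf.intros)
qed

subsection \<open>Symbols of differential operators\<close>

definition symbol_family :: "(int ^ ('d::finite) \<Rightarrow> complex ^ 'd \<Rightarrow> complex) \<Rightarrow> bool" where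
  "symbol_family p \<longleftrightarrow> (\<forall>a. p a \<in> polyf) \<and> finite {a. p a \<noteq> (\<lambda>_. 0)}"

text \<open>The family \<open>p\<close> stands for the sum of the operators
  \<open>t^a p a (s)\<close>, which send \<open>t^u\<close> to \<open>p a (u) t^(u + a)\<close>;
  hence the argument \<open>v - a\<close> in the coefficient of \<open>t^v\<close>.\<close>

definition op_of :: "(int ^ ('d::finite) \<Rightarrow> complex ^ 'd \<Rightarrow> complex) \<Rightarrow> 'd dop" where
  "op_of p = (\<lambda>f v. \<Sum>a | p a \<noteq> (\<lambda>_. 0). p a (cvec (v - a)) * f (v - a))"

definition single :: "int ^ 'd \<Rightarrow> (complex ^ 'd \<Rightarrow> complex) \<Rightarrow> int ^ 'd \<Rightarrow> complex ^ ('d::finite) \<Rightarrow> complex" where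
  "single a h = (\<lambda>b. if b = a then h else (\<lambda>_. 0))"

text \<open>Comes from the rule \<open>p(s) t^b = t^b p(s + b)\<close> for moving Euler operators
  past a monomial.\<close>

definition comp_symbol :: "(int ^ ('d::finite) \<Rightarrow> complex ^ 'd \<Rightarrow> complex) \<Rightarrow> (int ^ 'd \<Rightarrow> complex ^ 'd \<Rightarrow> complex) \<Rightarrow>
    int ^ 'd \<Rightarrow> complex ^ 'd \<Rightarrow> complex" where
  "comp_symbol p q = (\<lambda>c x. \<Sum>b | q b \<noteq> (\<lambda>_. 0). p (c - b) (x + cvec b) * q b x)"

lemma symbol_familyI:
  "(\<And>a. p a \<in> polyf) \<Longrightarrow> finite K \<Longrightarrow> (\<And>a. a \<notin> K \<Longrightarrow> p a = (\<lambda>_. 0)) \<Longrightarrow> symbol_family p"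
  unfolding symbol_family_def by (metis (mono_tags, lifting) finite_subset mem_Collect_eq subsetI)

lemma symbol_family_polyf: "symbol_family p \<Longrightarrow> p a \<in> polyf"
  and symbol_family_finite: "symbol_family p \<Longrightarrow> finite {a. p a \<noteq> (\<lambda>_. 0)}"
  by (auto simp: symbol_family_def)

lemma op_of_sum:
  assumes "finite K" "\<And>a. a \<notin> K \<Longrightarrow> p a = (\<lambda>_. 0)"
  shows "op_of p f v = (\<Sum>a\<in>K. p a (cvec (v - a)) * f (v - a))"
  unfolding op_of_def using assms by (intro sum.mono_neutral_left) auto

lemma symbol_family_single: "h \<in> polyf \<Longrightarrow> symbol_family (single a h)"
  by (rule symbol_familyI[of _ "{a}"]) (auto simp: single_def intro: polyf.intros)

lemma op_of_single: "op_of (single a h) f v = h (cvec (v - a)) * f (v - a)"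
  by (subst op_of_sum[of "{a}"]) (auto simp: single_def)

lemma comp_symbol_sum:
  assumes "finite K" "\<And>b. b \<notin> K \<Longrightarrow> q b = (\<lambda>_. 0)"
  shows "comp_symbol p q c x = (\<Sum>b\<in>K. p (c - b) (x + cvec b) * q b x)"
  unfolding comp_symbol_def using assms by (intro sum.mono_neutral_left) auto

lemma symbol_family_comp:
  assumes "symbol_family p" "symbol_family q"
  shows "symbol_family (comp_symbol p q)"
proof -
  define K where "K = {a. p a \<noteq> (\<lambda>_. 0)}"
  define L where "L = {a. q a \<noteq> (\<lambda>_. 0)}"
  have fin: "finite K" "finite L" using assms by (auto simp: K_def L_def symbol_family_def)
  show ?thesis
  proof (rule symbol_familyI[of _ "(\<lambda>(a, b). a + b) ` (K \<times> L)"])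
    show "comp_symbol p q c \<in> polyf" for c
      using assms unfolding comp_symbol_def symbol_family_def
      by (intro polyf_sum polyf.mult polyf_translate) auto
    show "comp_symbol p q c = (\<lambda>_. 0)" if "c \<notin> (\<lambda>(a, b). a + b) ` (K \<times> L)" for c
    proof
      have "p (c - b) = (\<lambda>_. 0)" if "b \<in> L" for b
      proof (rule ccontr)
        assume "p (c - b) \<noteq> (\<lambda>_. 0)"
        then have "(c - b, b) \<in> K \<times> L" using that by (simp add: K_def)
        from imageI[OF this, of "\<lambda>(a, b). a + b"] show False
          using \<open>c \<notin> _\<close> by simp
      qed
      then show "comp_symbol p q c x = 0" for x
        unfolding comp_symbol_def by (intro sum.neutral) (auto simp: L_def)
    qed
  qed (use fin in auto)
qed

lemma op_of_comp:
  assumes "symbol_family p" "symbol_family q"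
  shows "op_of p \<circ> op_of q = op_of (comp_symbol p q)"
proof (intro ext)
  fix f v
  define K where "K = {a. p a \<noteq> (\<lambda>_. 0)}"
  define L where "L = {a. q a \<noteq> (\<lambda>_. 0)}"
  define M where "M = (\<lambda>(a, b). a + b) ` (K \<times> L)"
  have fin: "finite K" "finite L" "finite M"
    using assms by (auto simp: K_def L_def M_def symbol_family_def)
  have p0: "a \<notin> K \<Longrightarrow> p a = (\<lambda>_. 0)" and q0: "a \<notin> L \<Longrightarrow> q a = (\<lambda>_. 0)" for a
    by (auto simp: K_def L_def)
  have M: "b \<in> L \<Longrightarrow> c \<notin> M \<Longrightarrow> p (c - b) = (\<lambda>_. 0)" for b c
  proof (rule ccontr)
    assume "b \<in> L" "c \<notin> M" "p (c - b) \<noteq> (\<lambda>_. 0)"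
    then have "(c - b, b) \<in> K \<times> L" by (simp add: K_def)
    from imageI[OF this, of "\<lambda>(a, b). a + b"] show False
      using \<open>c \<notin> M\<close> by (simp add: M_def)
  qed
  \<comment> \<open>For fixed \<open>b\<close> the sum is reindexed by the total degree
    \<open>c = a + b\<close> and padded with zero terms to \<open>M\<close>, which does not depend
    on \<open>b\<close>, so that the two sums can be swapped.\<close>
  have shift: "(\<Sum>a\<in>K. p a (cvec (v - a)) * (q b (cvec (v - a - b)) * f (v - a - b)))
      = (\<Sum>c\<in>M. p (c - b) (cvec (v - c) + cvec b) * q b (cvec (v - c)) * f (v - c))"
    if "b \<in> L" for b
  proof -
    have "(\<Sum>a\<in>K. p a (cvec (v - a)) * (q b (cvec (v - a - b)) * f (v - a - b)))
        = (\<Sum>c\<in>(\<lambda>a. a + b) ` K. p (c - b) (cvec (v - c) + cvec b) * q b (cvec (v - c)) * f (v - c))"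
      by (subst sum.reindex) (auto simp: inj_on_def cvec_add[symmetric] algebra_simps)
    also have "\<dots> = (\<Sum>c\<in>M. p (c - b) (cvec (v - c) + cvec b) * q b (cvec (v - c)) * f (v - c))"
    proof (rule sum.mono_neutral_left)
      show "(\<lambda>a. a + b) ` K \<subseteq> M"
        using that by (auto simp: M_def)
      show "\<forall>c\<in>M - (\<lambda>a. a + b) ` K. p (c - b) (cvec (v - c) + cvec b) * q b (cvec (v - c)) * f (v - c) = 0"
      proof
        fix c assume "c \<in> M - (\<lambda>a. a + b) ` K"
        then have "c - b \<notin> K" by (metis DiffE diff_add_cancel image_eqI)
        then show "p (c - b) (cvec (v - c) + cvec b) * q b (cvec (v - c)) * f (v - c) = 0"
          by (simp add: p0)
      qed
    qed (rule fin)
    finally show ?thesis .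
  qed
  have "(op_of p \<circ> op_of q) f v
      = (\<Sum>a\<in>K. \<Sum>b\<in>L. p a (cvec (v - a)) * (q b (cvec (v - a - b)) * f (v - a - b)))"
    using fin p0 q0 by (simp add: op_of_sum[of K] op_of_sum[of L] sum_distrib_left)
  also have "\<dots> = (\<Sum>b\<in>L. \<Sum>a\<in>K. p a (cvec (v - a)) * (q b (cvec (v - a - b)) * f (v - a - b)))"
    by (rule sum.swap)
  also have "\<dots> = (\<Sum>b\<in>L. \<Sum>c\<in>M. p (c - b) (cvec (v - c) + cvec b) * q b (cvec (v - c)) * f (v - c))"
    by (rule sum.cong[OF refl shift])
  also have "\<dots> = (\<Sum>c\<in>M. \<Sum>b\<in>L. p (c - b) (cvec (v - c) + cvec b) * q b (cvec (v - c)) * f (v - c))"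
    by (rule sum.swap)
  also have "\<dots> = (\<Sum>c\<in>M. comp_symbol p q c (cvec (v - c)) * f (v - c))"
    using fin q0 by (simp add: comp_symbol_sum[of L] sum_distrib_right)
  also have "\<dots> = op_of (comp_symbol p q) f v"
  proof (rule op_of_sum[symmetric])
    show "comp_symbol p q c = (\<lambda>_. 0)" if "c \<notin> M" for c
      using that fin q0 by (auto simp: comp_symbol_sum[of L] M)
  qed (rule fin)
  finally show "(op_of p \<circ> op_of q) f v = op_of (comp_symbol p q) f v" .
qed

lemma comp_symbol_single_right:
  "comp_symbol p (single b h) c x = p (c - b) (x + cvec b) * h x"
  by (subst comp_symbol_sum[of "{b}"]) (auto simp: single_def)

lemma symbol_family_add:
  assumes "symbol_family p" "symbol_family q"
  shows "symbol_family (\<lambda>a x. p a x + q a x)"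
  by (rule symbol_familyI[of _ "{a. p a \<noteq> (\<lambda>_. 0)} \<union> {a. q a \<noteq> (\<lambda>_. 0)}"])
    (use assms in \<open>auto simp: symbol_family_def intro: polyf.intros\<close>)

lemma op_of_add:
  assumes "symbol_family p" "symbol_family q"
  shows "op_add (op_of p) (op_of q) = op_of (\<lambda>a x. p a x + q a x)"
proof (intro ext)
  fix f v
  define K where "K = {a. p a \<noteq> (\<lambda>_. 0)} \<union> {a. q a \<noteq> (\<lambda>_. 0)}"
  have K: "finite K" using assms by (simp add: K_def symbol_family_def)
  show "op_add (op_of p) (op_of q) f v = op_of (\<lambda>a x. p a x + q a x) f v"
    unfolding op_add_def
    by (subst (1 2 3) op_of_sum[of K]) (use K in \<open>auto simp: K_def sum.distrib distrib_right\<close>)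
qed

section \<open>Faithfulness of symbols\<close>

definition delta :: "int ^ 'd \<Rightarrow> 'd coeffs" where
  "delta u = (\<lambda>v. if v = u then 1 else 0)"

lemma op_of_delta:
  assumes "symbol_family p"
  shows "op_of p (delta u) v = p (v - u) (cvec u)"
proof -
  define K where "K = insert (v - u) {a. p a \<noteq> (\<lambda>_. 0)}"
  have "op_of p (delta u) v = (\<Sum>a\<in>K. p a (cvec (v - a)) * delta u (v - a))"
    by (rule op_of_sum) (use assms in \<open>auto simp: K_def symbol_family_def\<close>)
  also have "\<dots> = (\<Sum>a\<in>K. if a = v - u then p (v - u) (cvec u) else 0)"
    by (intro sum.cong) (auto simp: delta_def)
  also have "\<dots> = p (v - u) (cvec u)"
    using assms by (simp add: K_def symbol_family_def)
  finally show ?thesis .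
qed

text \<open>The coefficient of \<open>t^(u + a)\<close> in the image of \<open>t^u\<close> is
  \<open>p a (cvec u)\<close>, and a polynomial is determined by its values at integer
  points.\<close>

lemma op_of_inject:
  assumes "symbol_family p" "symbol_family q" "op_of p = op_of q"
  shows "p = q"
proof
  fix a
  show "p a = q a"
  proof (rule polyf_eqI)
    fix u
    have "op_of p (delta u) (u + a) = op_of q (delta u) (u + a)"
      by (simp add: assms(3))
    then show "p a (cvec u) = q a (cvec u)"
      using assms(1,2) by (simp add: op_of_delta)
  qed (use assms in \<open>auto simp: symbol_family_def\<close>)
qed

section \<open>The Laurent Weyl algebra as the set of operators with a symbol family\<close>

lemma op_scal_eq_op_of: "op_scal c = op_of (single 0 (\<lambda>_. c))"
  by (intro ext) (simp add: op_of_single op_scal_def)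

lemma euler_eq_op_of: "euler i = op_of (single 0 (\<lambda>x. x $ i))"
  by (intro ext) (simp add: op_of_single euler_def mul_t_def partial_def unitv_def)

lemma weyl_laurent_imp_op_of:
  assumes "P \<in> weyl_laurent"
  shows "\<exists>p. symbol_family p \<and> P = op_of p"
  using assms
proof (induction rule: weyl_laurent.induct)
  case (scal c)
  then show ?case using op_scal_eq_op_of symbol_family_single polyf.const by blast
next
  case (tt i)
  have "mul_t i = op_of (single (unitv i) (\<lambda>_. 1))"
    by (intro ext) (simp add: op_of_single mul_t_def)
  then show ?case using symbol_family_single polyf.const by blast
next
  case (ttinv i)
  have "mul_tinv i = op_of (single (- unitv i) (\<lambda>_. 1))"
    by (intro ext) (simp add: op_of_single mul_tinv_def)
  then show ?case using symbol_family_single polyf.const by blast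
next
  case (dd i)
  have "partial i = op_of (single (- unitv i) (\<lambda>x. x $ i))"
    by (intro ext) (simp add: op_of_single partial_def unitv_def)
  then show ?case using symbol_family_single polyf.coord by blast
next
  case (add P Q)
  then obtain p q where "symbol_family p" "P = op_of p" "symbol_family q" "Q = op_of q"
    by blast
  then show ?case using op_of_add symbol_family_add by blast
next
  case (comp P Q)
  then obtain p q where "symbol_family p" "P = op_of p" "symbol_family q" "Q = op_of q"
    by blast
  then show ?case using op_of_comp symbol_family_comp by blast
qed

text \<open>The exponents of the monomials in the algebra form a submonoid of \<int>^d that contains
  every \<open>unitv i\<close> and \<open>- unitv i\<close>, hence everything.\<close>

lemma weyl_laurent_shift: "op_of (single a (\<lambda>_. 1)) \<in> weyl_laurent"
proof -
  define T where "T = {a :: int ^ 'a. op_of (single a (\<lambda>_. 1)) \<in> weyl_laurent}"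
  have zero: "0 \<in> T"
    using weyl_laurent.scal[of 1] by (simp add: T_def op_scal_eq_op_of)
  have add: "a + b \<in> T" if "a \<in> T" "b \<in> T" for a b
  proof -
    have "op_of (single a (\<lambda>_. 1)) \<circ> op_of (single b (\<lambda>_. 1)) = op_of (single (a + b) (\<lambda>_. 1))"
      by (intro ext) (simp add: op_of_single algebra_simps)
    moreover have "op_of (single a (\<lambda>_. 1)) \<circ> op_of (single b (\<lambda>_. 1)) \<in> weyl_laurent"
      using that unfolding T_def by (intro weyl_laurent.comp) simp_all
    ultimately show ?thesis
      by (simp only: T_def mem_Collect_eq)
  qed
  have unit: "unitv i \<in> T" for i
  proof -
    have "mul_t i = op_of (single (unitv i) (\<lambda>_. 1))"
      by (intro ext) (simp add: op_of_single mul_t_def)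
    then show ?thesis using weyl_laurent.tt[of i] by (simp add: T_def)
  qed
  have unit': "- unitv i \<in> T" for i
  proof -
    have "mul_tinv i = op_of (single (- unitv i) (\<lambda>_. 1))"
      by (intro ext) (simp add: op_of_single mul_tinv_def)
    then show ?thesis using weyl_laurent.ttinv[of i] by (simp add: T_def)
  qed
  have mult: "int n *s x \<in> T" if "x \<in> T" for n x
  proof (induction n)
    case 0
    then show ?case using zero by (simp add: vec_eq_iff)
  next
    case (Suc n)
    have "int (Suc n) *s x = x + int n *s x"
      by (simp add: vec_eq_iff algebra_simps)
    then show ?case using add[OF that Suc] by simp
  qed
  have "k *s unitv i \<in> T" for k i
  proof (cases "k \<ge> 0")
    case True
    then show ?thesis using mult[OF unit, of "nat k" i] by simp
  next
    case False
    have "k *s unitv i = int (nat (- k)) *s (- unitv i)"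
      using False by (simp add: vec_eq_iff)
    then show ?thesis using mult[OF unit'] by metis
  qed
  then have "(\<Sum>i\<in>I. (a $ i) *s unitv i) \<in> T" for I
    by (induction I rule: infinite_finite_induct) (auto simp: zero add)
  moreover have "(\<Sum>i\<in>UNIV. (a $ i) *s unitv i) = a"
    by (simp add: vec_eq_iff unitv_def if_distrib cong: if_cong)
  ultimately show ?thesis by (metis (mono_tags) T_def mem_Collect_eq)
qed

lemma weyl_laurent_single:
  assumes "h \<in> polyf"
  shows "op_of (single a h) \<in> weyl_laurent"
proof -
  have "op_of (single 0 h) \<in> weyl_laurent"
    using assms
  proof (induction rule: polyf.induct)
    case (const c)
    then show ?case using weyl_laurent.scal op_scal_eq_op_of by metis
  next
    case (coord i)
    show ?case
      unfolding euler_eq_op_of[symmetric] euler_def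
      by (intro weyl_laurent.comp weyl_laurent.tt weyl_laurent.dd)
  next
    case (add p q)
    have "op_add (op_of (single 0 p)) (op_of (single 0 q)) = op_of (single 0 (\<lambda>x. p x + q x))"
      by (intro ext) (simp add: op_add_def op_of_single algebra_simps)
    then show ?case using weyl_laurent.add[OF add.IH] by (simp only:)
  next
    case (mult p q)
    have "op_of (single 0 p) \<circ> op_of (single 0 q) = op_of (single 0 (\<lambda>x. p x * q x))"
      by (intro ext) (simp add: op_of_single algebra_simps)
    then show ?case using weyl_laurent.comp[OF mult.IH] by (simp only:)
  qed
  moreover have "op_of (single a (\<lambda>_. 1)) \<circ> op_of (single 0 h) = op_of (single a h)"
    by (intro ext) (simp add: op_of_single)
  ultimately show ?thesis
    using weyl_laurent.comp[OF weyl_laurent_shift] by metis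
qed

lemma op_of_in_weyl_laurent:
  assumes "symbol_family p"
  shows "op_of p \<in> weyl_laurent"
proof -
  have "(\<lambda>f v. \<Sum>a\<in>K. p a (cvec (v - a)) * f (v - a)) \<in> weyl_laurent" if "finite K" for K
    using that
  proof (induction K rule: finite_induct)
    case empty
    then show ?case using weyl_laurent.scal[of 0] by (simp add: op_scal_def)
  next
    case (insert a K)
    have eq: "(\<lambda>f v. \<Sum>a\<in>insert a K. p a (cvec (v - a)) * f (v - a))
      = op_add (op_of (single a (p a))) (\<lambda>f v. \<Sum>a\<in>K. p a (cvec (v - a)) * f (v - a))"
      using insert.hyps by (intro ext) (simp add: op_add_def op_of_single)
    show ?case
      unfolding eq
      by (intro weyl_laurent.add weyl_laurent_single insert.IH symbol_family_polyf assms)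
  qed
  from this[OF symbol_family_finite[OF assms]] show ?thesis
    by (simp add: op_of_def)
qed

section \<open>Symbols of the operators in D(R_A)\<close>

definition preserving :: "(int ^ ('d::finite)) set \<Rightarrow> (int ^ 'd \<Rightarrow> complex ^ 'd \<Rightarrow> complex) \<Rightarrow> bool" where
  "preserving A p \<longleftrightarrow> symbol_family p \<and>
     (\<forall>a. \<forall>u\<in>semigroupNA A. u + a \<notin> semigroupNA A \<longrightarrow> p a (cvec u) = 0)"

text \<open>Tested on \<open>t^u\<close> with \<open>u\<close> in \<nat>A: the coefficient of
  \<open>t^(u + a)\<close> in the image must vanish whenever \<open>u + a\<close> leaves \<nat>A.
  Conversely, this keeps the support of every image inside \<nat>A.\<close>

lemma DRA_iff: "P \<in> DRA A \<longleftrightarrow> (\<exists>p. preserving A p \<and> P = op_of p)"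
proof
  assume P: "P \<in> DRA A"
  then obtain p where p: "symbol_family p" "P = op_of p"
    using weyl_laurent_imp_op_of by (auto simp: DRA_def)
  have "p a (cvec u) = 0" if "u \<in> semigroupNA A" "u + a \<notin> semigroupNA A" for a u
  proof -
    have "delta u \<in> RA A" using that(1) by (auto simp: RA_def delta_def)
    then have "op_of p (delta u) \<in> RA A" using P p(2) by (auto simp: DRA_def)
    then have "op_of p (delta u) (u + a) = 0" using that(2) by (auto simp: RA_def)
    then show ?thesis using p(1) by (simp add: op_of_delta)
  qed
  then show "\<exists>p. preserving A p \<and> P = op_of p"
    using p by (auto simp: preserving_def)
next
  assume "\<exists>p. preserving A p \<and> P = op_of p"
  then obtain p where p: "preserving A p" "P = op_of p" by blast
  have "op_of p f \<in> RA A" if f: "f \<in> RA A" for f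
  proof -
    define K where "K = {a. p a \<noteq> (\<lambda>_. 0)}"
    have *: "\<exists>a u. a \<in> K \<and> f u \<noteq> 0 \<and> p a (cvec u) \<noteq> 0 \<and> v = u + a" if "op_of p f v \<noteq> 0" for v
    proof -
      have "(\<Sum>a\<in>K. p a (cvec (v - a)) * f (v - a)) \<noteq> 0"
        using that by (simp add: op_of_def K_def)
      from sum.not_neutral_contains_not_neutral[OF this]
      have "\<exists>a\<in>K. p a (cvec (v - a)) * f (v - a) \<noteq> 0" by blast
      then obtain a where a: "a \<in> K" "p a (cvec (v - a)) * f (v - a) \<noteq> 0" by blast
      then show ?thesis by (intro exI[of _ a] exI[of _ "v - a"]) simp
    qed
    have "{v. op_of p f v \<noteq> 0} \<subseteq> (\<lambda>(a, u). u + a) ` (K \<times> {u. f u \<noteq> 0})"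
      using * by fastforce
    moreover have "finite (K \<times> {u. f u \<noteq> 0})"
      using f p by (auto simp: RA_def K_def preserving_def symbol_family_def)
    ultimately have "finite {v. op_of p f v \<noteq> 0}"
      by (meson finite_imageI finite_subset)
    moreover have "v \<in> semigroupNA A" if v: "op_of p f v \<noteq> 0" for v
    proof -
      obtain a u where "f u \<noteq> 0" "p a (cvec u) \<noteq> 0" "v = u + a" using *[OF v] by blast
      moreover have "u \<in> semigroupNA A" using f \<open>f u \<noteq> 0\<close> by (auto simp: RA_def)
      ultimately show ?thesis using p(1) by (auto simp: preserving_def)
    qed
    ultimately show ?thesis by (auto simp: RA_def)
  qed
  then show "P \<in> DRA A"
    using p op_of_in_weyl_laurent by (auto simp: DRA_def preserving_def)
qed

subsection \<open>The annihilator of the simple quotient\<close>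

lemma comp_symbol_single_left:
  assumes "symbol_family t"
  shows "comp_symbol (single e r) t c x = r (x + cvec (c - e)) * t (c - e) x"
proof -
  define K where "K = insert (c - e) {a. t a \<noteq> (\<lambda>_. 0)}"
  have K: "finite K" using assms by (simp add: K_def symbol_family_def)
  have "comp_symbol (single e r) t c x = (\<Sum>d\<in>K. single e r (c - d) (x + cvec d) * t d x)"
    by (rule comp_symbol_sum[OF K]) (auto simp: K_def)
  also have "\<dots> = (\<Sum>d\<in>K. if d = c - e then r (x + cvec (c - e)) * t (c - e) x else 0)"
    by (intro sum.cong) (auto simp: single_def)
  also have "\<dots> = r (x + cvec (c - e)) * t (c - e) x"
    using K by (simp add: K_def)
  finally show ?thesis .
qed

lemma preserving_single:
  assumes "h \<in> polyf" "\<And>u. u \<in> semigroupNA A \<Longrightarrow> u + a \<notin> semigroupNA A \<Longrightarrow> h (cvec u) = 0"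
  shows "preserving A (single a h)"
  unfolding preserving_def using assms by (auto simp: symbol_family_single) (auto simp: single_def)

lemma preserving_family: "preserving A p \<Longrightarrow> symbol_family p"
  by (simp add: preserving_def)

lemma op_of_in_DRA: "preserving A p \<Longrightarrow> op_of p \<in> DRA A"
  by (auto simp: DRA_iff)

lemma DRA_comp: "P \<in> DRA A \<Longrightarrow> Q \<in> DRA A \<Longrightarrow> P \<circ> Q \<in> DRA A"
  by (auto simp: DRA_def weyl_laurent.comp)

lemma DRA_add:
  assumes "P \<in> DRA A" "Q \<in> DRA A"
  shows "op_add P Q \<in> DRA A"
proof -
  obtain p q where pq: "preserving A p" "P = op_of p" "preserving A q" "Q = op_of q"
    using assms by (auto simp: DRA_iff)
  then have "preserving A (\<lambda>a x. p a x + q a x)"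
    by (simp add: preserving_def symbol_family_add)
  then show ?thesis
    unfolding pq op_of_add[OF preserving_family[OF pq(1)] preserving_family[OF pq(3)]]
    by (rule op_of_in_DRA)
qed

lemma DRA_degree_zero: "h \<in> polyf \<Longrightarrow> op_of (single 0 h) \<in> DRA A"
  by (intro op_of_in_DRA preserving_single) auto

lemma DRA_scal: "op_scal c \<in> DRA A"
  unfolding op_scal_eq_op_of by (intro DRA_degree_zero polyf.const)

lemma op_scal_comp: "op_scal c \<circ> op_scal d = op_scal (c * d)"
  by (intro ext) (simp add: op_scal_def)

lemma op_of_comp_add:
  "op_of r \<circ> op_add P Q = op_add (op_of r \<circ> P) (op_of r \<circ> Q)"
  by (intro ext) (simp add: op_add_def op_of_def sum.distrib distrib_left)

section \<open>Left ideals described by symbols\<close>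

definition symbol :: "('d::finite) dop \<Rightarrow> int ^ 'd \<Rightarrow> complex ^ 'd \<Rightarrow> complex" where
  "symbol P = (THE p. symbol_family p \<and> op_of p = P)"

lemma symbol_op_of: "symbol_family p \<Longrightarrow> symbol (op_of p) = p"
  unfolding symbol_def by (intro the_equality) (auto intro: op_of_inject)

text \<open>The factor \<open>s_i - \<alpha>_i\<close> has degree zero and stands on the right, so
  it multiplies each component of the symbol by \<open>x $ i - \<alpha> $ i\<close> without any
  shift.\<close>

lemma Kideal_eq:
  "Kideal A \<alpha> = {op_of (\<lambda>a x. \<Sum>i\<in>UNIV. h i a x * (x $ i - \<alpha> $ i)) | h. \<forall>i. preserving A (h i)}"
proof -
  have eq: "(\<lambda>f v. \<Sum>i\<in>UNIV. (op_of (h i) \<circ> op_add (euler i) (op_scal (- \<alpha> $ i))) f v)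
      = op_of (\<lambda>a x. \<Sum>i\<in>UNIV. h i a x * (x $ i - \<alpha> $ i))" if "\<forall>i. preserving A (h i)" for h
  proof (intro ext)
    fix f v
    define K where "K = (\<Union>i. {a. h i a \<noteq> (\<lambda>_. 0)})"
    have K: "finite K"
      using that by (auto simp: K_def preserving_def symbol_family_def)
    have out: "a \<notin> K \<Longrightarrow> h i a = (\<lambda>_. 0)" for i a
      by (auto simp: K_def)
    have "(op_of (h i) \<circ> op_add (euler i) (op_scal (- \<alpha> $ i))) f v
        = (\<Sum>a\<in>K. h i a (cvec (v - a)) * (cvec (v - a) $ i - \<alpha> $ i) * f (v - a))" for i
      unfolding o_apply
      by (subst op_of_sum[OF K out])
        (simp_all add: euler_eq_op_of op_of_single op_add_def op_scal_def algebra_simps)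
    then have "(\<Sum>i\<in>UNIV. (op_of (h i) \<circ> op_add (euler i) (op_scal (- \<alpha> $ i))) f v)
        = (\<Sum>a\<in>K. (\<Sum>i\<in>UNIV. h i a (cvec (v - a)) * (cvec (v - a) $ i - \<alpha> $ i)) * f (v - a))"
      by (simp only: sum_distrib_right sum.swap[of _ K])
    also have "\<dots> = op_of (\<lambda>a x. \<Sum>i\<in>UNIV. h i a x * (x $ i - \<alpha> $ i)) f v"
      by (rule op_of_sum[OF K, symmetric]) (simp add: out)
    finally show "(\<Sum>i\<in>UNIV. (op_of (h i) \<circ> op_add (euler i) (op_scal (- \<alpha> $ i))) f v)
      = op_of (\<lambda>a x. \<Sum>i\<in>UNIV. h i a x * (x $ i - \<alpha> $ i)) f v" .
  qed
  show ?thesis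
  proof (intro equalityI subsetI)
    fix P assume "P \<in> Kideal A \<alpha>"
    then obtain Q where Q: "\<forall>i. Q i \<in> DRA A"
      and P: "P = (\<lambda>f v. \<Sum>i\<in>UNIV. (Q i \<circ> op_add (euler i) (op_scal (- \<alpha> $ i))) f v)"
      unfolding Kideal_def by blast
    from Q obtain h where h: "\<forall>i. preserving A (h i) \<and> Q i = op_of (h i)"
      unfolding DRA_iff by metis
    then have "P = op_of (\<lambda>a x. \<Sum>i\<in>UNIV. h i a x * (x $ i - \<alpha> $ i))"
      unfolding P using eq[of h] by simp
    then show "P \<in> {op_of (\<lambda>a x. \<Sum>i\<in>UNIV. h i a x * (x $ i - \<alpha> $ i)) | h. \<forall>i. preserving A (h i)}"
      using h by blast
  next
    fix P assume "P \<in> {op_of (\<lambda>a x. \<Sum>i\<in>UNIV. h i a x * (x $ i - \<alpha> $ i)) | h. \<forall>i. preserving A (h i)}"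
    then obtain h where h: "\<forall>i. preserving A (h i)"
      and P: "P = op_of (\<lambda>a x. \<Sum>i\<in>UNIV. h i a x * (x $ i - \<alpha> $ i))" by blast
    have "P = (\<lambda>f v. \<Sum>i\<in>UNIV. (op_of (h i) \<circ> op_add (euler i) (op_scal (- \<alpha> $ i))) f v)"
      unfolding P by (rule eq[OF h, symmetric])
    then show "P \<in> Kideal A \<alpha>"
      unfolding Kideal_def mem_Collect_eq
      by (intro exI[of _ "\<lambda>i. op_of (h i)"] conjI) (use h in \<open>auto intro: op_of_in_DRA\<close>)
  qed
qed

lemma preserving_Kideal_symbol:
  assumes "\<forall>i. preserving A (h i)"
  shows "preserving A (\<lambda>a x. \<Sum>i\<in>UNIV. h i a x * (x $ i - \<alpha> $ i))"
  unfolding preserving_def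
proof
  show "symbol_family (\<lambda>a x. \<Sum>i\<in>UNIV. h i a x * (x $ i - \<alpha> $ i))"
  proof (rule symbol_familyI[of _ "\<Union>i. {a. h i a \<noteq> (\<lambda>_. 0)}"])
    show "(\<lambda>x. \<Sum>i\<in>UNIV. h i a x * (x $ i - \<alpha> $ i)) \<in> polyf" for a
      using assms by (intro polyf_sum polyf.mult polyf_diff polyf.intros)
        (auto simp: preserving_def symbol_family_def)
  qed (use assms in \<open>auto simp: preserving_def symbol_family_def\<close>)
qed (use assms in \<open>auto simp: preserving_def\<close>)

text \<open>\<open>symbol P 0 \<alpha>\<close> is the component of the class of \<open>P\<close> in
  the weight space of M(\<alpha>) at \<open>\<alpha>\<close>, a line spanned by the class of 1. The
  classes from which no operator leads back to that line form the largest proper submodule.\<close>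

definition killing_ideal :: "(int ^ ('d::finite)) set \<Rightarrow> complex ^ 'd \<Rightarrow> 'd dop set" where
  "killing_ideal A \<alpha> = {P \<in> DRA A. \<forall>R\<in>DRA A. symbol (R \<circ> P) 0 \<alpha> = 0}"

lemma left_ideal_killing_ideal: "left_ideal (DRA A) (killing_ideal A \<alpha>)"
  unfolding left_ideal_def
proof (intro conjI ballI)
  show "killing_ideal A \<alpha> \<subseteq> DRA A" by (auto simp: killing_ideal_def)
  have zero: "symbol (op_scal 0) 0 \<alpha> = 0"
    by (simp add: op_scal_eq_op_of symbol_op_of symbol_family_single polyf.const) (simp add: single_def)
  have "R \<circ> op_scal 0 = op_scal 0" if "R \<in> DRA A" for R
    using that by (auto simp: DRA_iff op_scal_def op_of_def fun_eq_iff)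
  then show "op_scal 0 \<in> killing_ideal A \<alpha>"
    using zero DRA_scal by (auto simp: killing_ideal_def)
next
  fix P Q assume P: "P \<in> killing_ideal A \<alpha>" and Q: "Q \<in> killing_ideal A \<alpha>"
  have "symbol (R \<circ> op_add P Q) 0 \<alpha> = 0" if R: "R \<in> DRA A" for R
  proof -
    have "R \<circ> P \<in> DRA A" "R \<circ> Q \<in> DRA A"
      using P Q R by (auto simp: killing_ideal_def DRA_comp)
    then obtain p q where pq: "symbol_family p" "R \<circ> P = op_of p" "symbol_family q" "R \<circ> Q = op_of q"
      by (auto simp: DRA_iff preserving_def)
    obtain r where "R = op_of r" using R by (auto simp: DRA_iff)
    then have "R \<circ> op_add P Q = op_of (\<lambda>a x. p a x + q a x)"
      using op_of_comp_add[of r P Q] pq by (simp add: op_of_add)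
    moreover have "p 0 \<alpha> = 0" "q 0 \<alpha> = 0"
      using P Q R pq symbol_op_of by (fastforce simp: killing_ideal_def)+
    ultimately show ?thesis
      using pq by (simp add: symbol_op_of symbol_family_add)
  qed
  then show "op_add P Q \<in> killing_ideal A \<alpha>"
    using P Q by (auto simp: killing_ideal_def DRA_add)
next
  fix Q P assume Q: "Q \<in> DRA A" and P: "P \<in> killing_ideal A \<alpha>"
  have "symbol (R \<circ> (Q \<circ> P)) 0 \<alpha> = 0" if "R \<in> DRA A" for R
  proof -
    have "R \<circ> Q \<in> DRA A" using that Q by (rule DRA_comp)
    then show ?thesis using P by (simp only: killing_ideal_def mem_Collect_eq o_assoc)
  qed
  then show "Q \<circ> P \<in> killing_ideal A \<alpha>"
    using P Q by (auto simp: killing_ideal_def intro: DRA_comp)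
qed

lemma Kideal_subset_killing_ideal: "Kideal A \<alpha> \<subseteq> killing_ideal A \<alpha>"
proof
  fix P assume "P \<in> Kideal A \<alpha>"
  then obtain h where h: "\<forall>i. preserving A (h i)"
    and P: "P = op_of (\<lambda>a x. \<Sum>i\<in>UNIV. h i a x * (x $ i - \<alpha> $ i))"
    unfolding Kideal_eq by blast
  define t where "t = (\<lambda>a x. \<Sum>i\<in>UNIV. h i a x * (x $ i - \<alpha> $ i))"
  have t: "preserving A t" and t0: "t a \<alpha> = 0" for a
    unfolding t_def using preserving_Kideal_symbol[OF h] by auto
  have "symbol (R \<circ> op_of t) 0 \<alpha> = 0" if R: "R \<in> DRA A" for R
  proof -
    obtain r where r: "symbol_family r" "R = op_of r"
      using R unfolding DRA_iff preserving_def by blast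
    have "symbol (R \<circ> op_of t) = comp_symbol r t"
      by (simp only: r op_of_comp symbol_family_comp symbol_op_of t[THEN preserving_family])
    then show ?thesis by (simp add: comp_symbol_def t0)
  qed
  then show "P \<in> killing_ideal A \<alpha>"
    using t by (simp add: killing_ideal_def P t_def[symmetric] op_of_in_DRA)
qed

lemma killing_ideal_proper: "killing_ideal A \<alpha> \<noteq> DRA A"
proof
  assume "killing_ideal A \<alpha> = DRA A"
  then have "op_scal 1 \<in> killing_ideal A \<alpha>" using DRA_scal by blast
  then have "symbol (op_scal 1 \<circ> op_scal 1) 0 \<alpha> = 0"
    unfolding killing_ideal_def using DRA_scal by blast
  then have "symbol (op_of (single 0 (\<lambda>_. 1))) 0 \<alpha> = 0"
    unfolding op_scal_comp mult_1 unfolding op_scal_eq_op_of .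
  then show False
    by (simp add: symbol_op_of symbol_family_single polyf.const) (simp add: single_def)
qed

text \<open>If some \<open>Q P\<close> has symbol \<open>p\<close> with \<open>p 0 \<alpha> \<noteq> 0\<close>, an interpolating polynomial \<open>g\<close> in the
  Euler operators isolates the weight \<open>\<alpha>\<close>: the symbol of \<open>g Q P - 1\<close> vanishes at \<open>\<alpha>\<close> in every
  degree.\<close>

lemma left_ideal_subset_killing_ideal:
  assumes I: "left_ideal (DRA A) I" and K: "Kideal A \<alpha> \<subseteq> I" and proper: "I \<noteq> DRA A"
  shows "I \<subseteq> killing_ideal A \<alpha>"
proof
  fix P assume P: "P \<in> I"
  have add: "\<And>P Q. P \<in> I \<Longrightarrow> Q \<in> I \<Longrightarrow> op_add P Q \<in> I"
    and comp: "\<And>P Q. Q \<in> DRA A \<Longrightarrow> P \<in> I \<Longrightarrow> Q \<circ> P \<in> I" and sub: "I \<subseteq> DRA A"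
    using I by (auto simp: left_ideal_def)
  show "P \<in> killing_ideal A \<alpha>"
  proof (rule ccontr)
    assume "P \<notin> killing_ideal A \<alpha>"
    then obtain Q where Q: "Q \<in> DRA A" "symbol (Q \<circ> P) 0 \<alpha> \<noteq> 0"
      using P sub by (auto simp: killing_ideal_def)
    have QP: "Q \<circ> P \<in> I" using comp Q(1) P by blast
    then obtain p where p: "preserving A p" "Q \<circ> P = op_of p"
      using sub DRA_iff by blast
    have fam: "symbol_family p" using p(1) by (rule preserving_family)
    have p0: "p 0 \<alpha> \<noteq> 0" using Q(2) p(2) symbol_op_of[OF fam] by simp
    define K where "K = {a. p a \<noteq> (\<lambda>_. 0)} - {0}"
    have "finite K" "0 \<notin> K" using fam by (auto simp: K_def symbol_family_def)
    then obtain g0 where g0: "g0 \<in> polyf" "g0 \<alpha> = 1" "\<forall>a\<in>K. g0 (\<alpha> + cvec a) = 0"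
      using polyf_separating_points by metis
    \<comment> \<open>Scaling makes the degree-zero symbol of \<open>g Q P\<close> equal to 1 at
      \<open>\<alpha>\<close>.\<close>
    define g where "g = (\<lambda>x. inverse (p 0 \<alpha>) * g0 x)"
    have g: "g \<in> polyf" "g \<alpha> * p 0 \<alpha> = 1" "\<And>a. a \<in> K \<Longrightarrow> g (\<alpha> + cvec a) = 0"
      using g0 p0 by (auto simp: g_def polyf_cmult)
    obtain k where k: "\<And>i. k i \<in> polyf"
      "\<And>x. g x * p 0 x = g \<alpha> * p 0 \<alpha> + (\<Sum>i\<in>UNIV. k i x * (x $ i - \<alpha> $ i))"
      using polyf_remainder[OF polyf.mult[OF g(1) symbol_family_polyf[OF fam, of 0]], of \<alpha>] by blast
    have "\<forall>a. \<exists>h. (\<forall>i. h i \<in> polyf) \<and>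
        (\<forall>x. g (x + cvec a) = g (\<alpha> + cvec a) + (\<Sum>i\<in>UNIV. h i x * (x $ i - \<alpha> $ i)))"
      using polyf_remainder[OF polyf_translate[OF g(1)], of _ \<alpha>] by blast
    then obtain h where h: "\<And>a i. h a i \<in> polyf"
      "\<And>a x. g (x + cvec a) = g (\<alpha> + cvec a) + (\<Sum>i\<in>UNIV. h a i x * (x $ i - \<alpha> $ i))"
      by metis
    \<comment> \<open>Cofactors of the \<open>x $ i - \<alpha> $ i\<close> in the symbol of
      \<open>g Q P - 1\<close>. In degree \<open>a \<noteq> 0\<close> the factor \<open>p a\<close>
      is kept, so the vanishing conditions of D(R_A) survive; degree zero carries none.\<close>
    define q where "q = (\<lambda>i a x. if a = 0 then k i x else h a i x * p a x)"
    have q: "preserving A (q i)" for i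
      unfolding preserving_def
    proof
      show "symbol_family (q i)"
      proof (rule symbol_familyI[of _ "insert 0 K"])
        show "q i a \<in> polyf" for a
          using k(1) h(1) symbol_family_polyf[OF fam]
          by (cases "a = 0") (auto simp: q_def intro: polyf.mult)
      qed (use \<open>finite K\<close> in \<open>auto simp: q_def K_def\<close>)
      show "\<forall>a. \<forall>u\<in>semigroupNA A. u + a \<notin> semigroupNA A \<longrightarrow> q i a (cvec u) = 0"
        using p(1) by (auto simp: q_def preserving_def)
    qed
    define N where "N = op_of (\<lambda>a x. \<Sum>i\<in>UNIV. q i a x * (x $ i - \<alpha> $ i))"
    have "N \<in> Kideal A \<alpha>"
      unfolding Kideal_eq N_def using q by blast
    then have N: "N \<in> I" using K by blast
    have "(\<lambda>a x. (\<Sum>i\<in>UNIV. q i a x * (x $ i - \<alpha> $ i)) + single 0 (\<lambda>_. 1) a x)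
        = comp_symbol (single 0 g) p"
    proof (intro ext)
      fix a x
      show "(\<Sum>i\<in>UNIV. q i a x * (x $ i - \<alpha> $ i)) + single 0 (\<lambda>_. 1) a x = comp_symbol (single 0 g) p a x"
      proof (cases "a = 0")
        case True
        then show ?thesis
          using k(2)[of x] g(2)
          unfolding comp_symbol_single_left[OF fam] by (simp add: q_def single_def)
      next
        case False
        have "g (\<alpha> + cvec a) * p a x = 0"
          using g(3)[of a] False by (cases "a \<in> K") (auto simp: K_def)
        moreover have "(\<Sum>i\<in>UNIV. q i a x * (x $ i - \<alpha> $ i))
            = (\<Sum>i\<in>UNIV. h a i x * (x $ i - \<alpha> $ i)) * p a x"
          using False by (simp add: q_def sum_distrib_right sum_distrib_left mult_ac)
        ultimately show ?thesis
          using False h(2)[of x a]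
          unfolding comp_symbol_single_left[OF fam] by (simp add: single_def distrib_right)
      qed
    qed
    note symbol_eq = this
    have "op_add N (op_scal 1) = op_of (\<lambda>a x. (\<Sum>i\<in>UNIV. q i a x * (x $ i - \<alpha> $ i)) + single 0 (\<lambda>_. 1) a x)"
      unfolding N_def op_scal_eq_op_of
      by (intro op_of_add preserving_family[OF preserving_Kideal_symbol[of A]] symbol_family_single
          polyf.const allI q)
    also have "\<dots> = op_of (single 0 g) \<circ> op_of p"
      unfolding symbol_eq by (rule op_of_comp[OF symbol_family_single[OF g(1)] fam, symmetric])
    finally have "op_add N (op_scal 1) = op_of (single 0 g) \<circ> (Q \<circ> P)"
      unfolding p(2) .
    then have N1: "op_add N (op_scal 1) \<in> I"
      using comp[OF DRA_degree_zero[OF g(1)] QP] by simp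
    have "op_add (op_add N (op_scal 1)) (op_scal (- 1) \<circ> N) \<in> I"
      by (rule add[OF N1 comp[OF DRA_scal N]])
    moreover have "op_add (op_add N (op_scal 1)) (op_scal (- 1) \<circ> N) = op_scal 1"
      by (intro ext) (simp add: op_add_def op_scal_def)
    ultimately have "op_scal 1 \<in> I" by metis
    then have "R \<in> I" if "R \<in> DRA A" for R
    proof -
      have "R \<circ> op_scal 1 \<in> I" using comp that \<open>op_scal 1 \<in> I\<close> by blast
      moreover have "R \<circ> op_scal 1 = R" by (intro ext) (simp add: op_scal_def)
      ultimately show ?thesis by metis
    qed
    then show False using proper sub by blast
  qed
qed

text \<open>The preceding lemmas make \<open>killing_ideal\<close> the greatest proper left ideal
  above \<open>Kideal\<close>, and a greatest element is unique.\<close>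

lemma Jideal_eq: "Jideal A \<alpha> = killing_ideal A \<alpha>"
  unfolding Jideal_def
proof (rule the_equality)
  show "left_ideal (DRA A) (killing_ideal A \<alpha>) \<and> Kideal A \<alpha> \<subseteq> killing_ideal A \<alpha> \<and>
    killing_ideal A \<alpha> \<noteq> DRA A \<and>
    (\<forall>I. left_ideal (DRA A) I \<and> Kideal A \<alpha> \<subseteq> I \<and> I \<noteq> DRA A \<longrightarrow> I \<subseteq> killing_ideal A \<alpha>)"
    using left_ideal_killing_ideal Kideal_subset_killing_ideal killing_ideal_proper
      left_ideal_subset_killing_ideal by blast
  show "J = killing_ideal A \<alpha>"
    if "left_ideal (DRA A) J \<and> Kideal A \<alpha> \<subseteq> J \<and> J \<noteq> DRA A \<and>
      (\<forall>I. left_ideal (DRA A) I \<and> Kideal A \<alpha> \<subseteq> I \<and> I \<noteq> DRA A \<longrightarrow> I \<subseteq> J)" for J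
    using that left_ideal_killing_ideal[of A \<alpha>] Kideal_subset_killing_ideal[of A \<alpha>]
      killing_ideal_proper[of A \<alpha>] left_ideal_subset_killing_ideal[of A J \<alpha>] by blast
qed

section \<open>The annihilator in terms of reachability\<close>

definition reach :: "(int ^ ('d::finite)) set \<Rightarrow> complex ^ 'd \<Rightarrow> int ^ 'd \<Rightarrow> bool" where
  "reach A \<alpha> a \<longleftrightarrow> (\<exists>p\<in>polyf. p \<alpha> \<noteq> 0 \<and>
     (\<forall>u\<in>semigroupNA A. u + a \<notin> semigroupNA A \<longrightarrow> p (cvec u) = 0))"

lemma preserving_imp_reach: "preserving A p \<Longrightarrow> p a \<alpha> \<noteq> 0 \<Longrightarrow> reach A \<alpha> a"
  unfolding reach_def preserving_def symbol_family_def by blast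

text \<open>For \<open>Q = t^b q(s)\<close> and \<open>R = t^(-(a + b)) r(s)\<close>, the operator
  \<open>R P Q\<close> contributes \<open>r(\<alpha> + a + b) p a (\<alpha> + b) q(\<alpha>)\<close>
  to the degree-zero symbol at \<open>\<alpha>\<close>; in general the symbol there is a sum of such
  products. The outer factors can be made nonzero exactly under the two \<open>reach\<close>
  conditions.\<close>

lemma op_of_in_AnnL_iff:
  assumes "preserving A p"
  shows "op_of p \<in> AnnL A \<alpha> \<longleftrightarrow>
    (\<forall>a b. reach A \<alpha> b \<longrightarrow> reach A (\<alpha> + cvec (a + b)) (- (a + b)) \<longrightarrow> p a (\<alpha> + cvec b) = 0)"
proof
  assume ann: "op_of p \<in> AnnL A \<alpha>"
  show "\<forall>a b. reach A \<alpha> b \<longrightarrow> reach A (\<alpha> + cvec (a + b)) (- (a + b)) \<longrightarrow> p a (\<alpha> + cvec b) = 0"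
  proof (intro allI impI)
    fix a b assume "reach A \<alpha> b" "reach A (\<alpha> + cvec (a + b)) (- (a + b))"
    then obtain q r where q: "q \<in> polyf" "q \<alpha> \<noteq> 0"
        "\<forall>u\<in>semigroupNA A. u + b \<notin> semigroupNA A \<longrightarrow> q (cvec u) = 0"
      and r: "r \<in> polyf" "r (\<alpha> + cvec (a + b)) \<noteq> 0"
        "\<forall>u\<in>semigroupNA A. u + (- (a + b)) \<notin> semigroupNA A \<longrightarrow> r (cvec u) = 0"
      unfolding reach_def by blast
    define Q where "Q = single b q"
    define R where "R = single (- (a + b)) r"
    have pres: "preserving A Q" "preserving A R"
      using q r unfolding Q_def R_def by (auto intro!: preserving_single)
    have fam: "symbol_family p" "symbol_family Q" "symbol_family R"
      using pres assms by (auto intro: preserving_family)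
    have "op_of p \<circ> op_of Q \<in> killing_ideal A \<alpha>"
      using ann pres(1) by (auto simp: AnnL_def Jideal_eq op_of_in_DRA)
    then have "symbol (op_of R \<circ> (op_of p \<circ> op_of Q)) 0 \<alpha> = 0"
      using pres(2) by (auto simp: killing_ideal_def op_of_in_DRA)
    then have "comp_symbol R (comp_symbol p Q) 0 \<alpha> = 0"
      by (simp only: op_of_comp fam symbol_family_comp symbol_op_of)
    then have "r (\<alpha> + cvec (a + b)) * (p a (\<alpha> + cvec b) * q \<alpha>) = 0"
      unfolding R_def comp_symbol_single_left[OF symbol_family_comp[OF fam(1,2)]]
      unfolding Q_def comp_symbol_single_right by (simp add: add.commute)
    then show "p a (\<alpha> + cvec b) = 0"
      using q(2) r(2) mult_eq_0_iff by blast
  qed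
next
  assume van: "\<forall>a b. reach A \<alpha> b \<longrightarrow> reach A (\<alpha> + cvec (a + b)) (- (a + b)) \<longrightarrow> p a (\<alpha> + cvec b) = 0"
  have "symbol (R \<circ> (op_of p \<circ> Q)) 0 \<alpha> = 0" if QR: "Q \<in> DRA A" "R \<in> DRA A" for Q R
  proof -
    obtain q r where qr: "preserving A q" "Q = op_of q" "preserving A r" "R = op_of r"
      using QR unfolding DRA_iff by blast
    have fam: "symbol_family p" "symbol_family q" "symbol_family r"
      using qr assms by (auto intro: preserving_family)
    have "r (0 - c) (\<alpha> + cvec c) * (p (c - b) (\<alpha> + cvec b) * q b \<alpha>) = 0" for b c
    proof (cases "q b \<alpha> = 0 \<or> r (0 - c) (\<alpha> + cvec c) = 0")
      case False
      then have "reach A \<alpha> b" "reach A (\<alpha> + cvec (c - b + b)) (- (c - b + b))"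
        using preserving_imp_reach[OF qr(1)] preserving_imp_reach[OF qr(3), of "- c"] by auto
      then show ?thesis using van by simp
    qed auto
    then have "comp_symbol r (comp_symbol p q) 0 \<alpha> = 0"
      unfolding comp_symbol_def sum_distrib_left by (intro sum.neutral ballI)
    then show ?thesis
      unfolding qr by (simp only: op_of_comp fam symbol_family_comp symbol_op_of)
  qed
  then show "op_of p \<in> AnnL A \<alpha>"
    using assms by (auto simp: AnnL_def Jideal_eq killing_ideal_def op_of_in_DRA intro: DRA_comp)
qed

subsection \<open>Reachability in terms of exponents\<close>

definition cspan :: "(int ^ ('d::finite)) set \<Rightarrow> (complex ^ 'd) set" where
  "cspan F = {x. \<exists>c. x = (\<Sum>f\<in>F. c f *s cvec f)}"

text \<open>\<open>localized A F\<close> is \<open>\<nat>A + \<int>F\<close> for \<open>F \<subseteq> A\<close>.\<close>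

definition localized :: "(int ^ 'd) set \<Rightarrow> (int ^ 'd) set \<Rightarrow> (int ^ ('d::finite)) set" where
  "localized A F = {x. \<exists>k. (\<forall>a\<in>A - F. k a \<ge> 0) \<and> x = (\<Sum>a\<in>A. k a *s a)}"

text \<open>This is \<open>E\<^sub>F(\<alpha>)\<close>. It is used for all subsets \<open>F\<close>
  of \<open>A\<close>, not only for those on faces of the cone, so no convex geometry
  enters.\<close>

definition exponents :: "(int ^ 'd) set \<Rightarrow> (int ^ 'd) set \<Rightarrow> complex ^ 'd \<Rightarrow> (complex ^ ('d::finite)) set" where
  "exponents A F \<alpha> = {x \<in> cspan F. \<exists>b\<in>localized A F. \<alpha> = x + cvec b}"

lemma cspanI: "x = (\<Sum>f\<in>F. c f *s cvec f) \<Longrightarrow> x \<in> cspan F"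
  by (auto simp: cspan_def)

lemma cspan_zero: "0 \<in> cspan F"
  unfolding cspan_def mem_Collect_eq by (rule exI[of _ "\<lambda>_. 0"]) (simp add: vec_eq_iff)

lemma cspan_add: "x \<in> cspan F \<Longrightarrow> y \<in> cspan F \<Longrightarrow> x + y \<in> cspan F"
proof -
  assume "x \<in> cspan F" "y \<in> cspan F"
  then obtain c d where "x = (\<Sum>f\<in>F. c f *s cvec f)" "y = (\<Sum>f\<in>F. d f *s cvec f)"
    by (auto simp: cspan_def)
  then have "x + y = (\<Sum>f\<in>F. (c f + d f) *s cvec f)"
    by (simp add: sum.distrib vector_sadd_rdistrib)
  then show ?thesis by (rule cspanI)
qed

lemma cspan_scale: "x \<in> cspan F \<Longrightarrow> r *s x \<in> cspan F"
proof -
  assume "x \<in> cspan F"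
  then obtain c where "x = (\<Sum>f\<in>F. c f *s cvec f)"
    by (auto simp: cspan_def)
  then have "r *s x = (\<Sum>f\<in>F. (r * c f) *s cvec f)"
    by (simp add: vec.scale_sum_right)
  then show ?thesis by (rule cspanI)
qed

lemma cspan_minus: "x \<in> cspan F \<Longrightarrow> - x \<in> cspan F"
  using cspan_scale[of x F "- 1"] by (simp add: vector_smult_lneg)

lemma cspan_diff: "x \<in> cspan F \<Longrightarrow> y \<in> cspan F \<Longrightarrow> x - y \<in> cspan F"
  using cspan_add[OF _ cspan_minus, of x F y] by simp

lemma cvec_int_comb: "cvec (\<Sum>f\<in>F. k f *s f) = (\<Sum>f\<in>F. of_int (k f) *s cvec f)"
  by (simp add: cvec_sum cvec_scale)

lemma cspan_int_comb: "cvec (\<Sum>f\<in>F. k f *s f) \<in> cspan F"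
  unfolding cvec_int_comb cspan_def mem_Collect_eq by (rule exI) (rule refl)

lemma cspan_mono:
  assumes "finite G" "F \<subseteq> G" "x \<in> cspan F"
  shows "x \<in> cspan G"
proof -
  obtain c where "x = (\<Sum>f\<in>F. c f *s cvec f)"
    using assms(3) by (auto simp: cspan_def)
  also have "\<dots> = (\<Sum>f\<in>G. (if f \<in> F then c f else 0) *s cvec f)"
    using assms(1,2) by (intro sum.mono_neutral_cong_left) auto
  finally show ?thesis by (rule cspanI)
qed

lemma cspan_member: "finite F \<Longrightarrow> f \<in> F \<Longrightarrow> cvec f \<in> cspan F"
proof -
  assume "finite F" "f \<in> F"
  have "cvec f \<in> cspan {f}"
    unfolding cspan_def mem_Collect_eq by (rule exI[of _ "\<lambda>_. 1"]) simp
  then show ?thesis using cspan_mono[OF \<open>finite F\<close>, of "{f}"] \<open>f \<in> F\<close> by simp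
qed

section \<open>Separation of points from complex spans\<close>

definition linear_form :: "(complex ^ ('d::finite) \<Rightarrow> complex) \<Rightarrow> bool" where
  "linear_form l \<longleftrightarrow> l \<in> polyf \<and> (\<forall>x y. l (x + y) = l x + l y) \<and> (\<forall>c x. l (c *s x) = c * l x)"

lemma linear_form_vanishes_on_cspan:
  assumes "linear_form l" "\<And>f. f \<in> F \<Longrightarrow> l (cvec f) = 0" "x \<in> cspan F"
  shows "l x = 0"
proof -
  obtain c where x: "x = (\<Sum>f\<in>F. c f *s cvec f)"
    using assms(3) by (auto simp: cspan_def)
  have "l (0 *s 0) = 0"
    using assms(1) by (simp only: linear_form_def mult_zero_left)
  then have l0: "l 0 = 0" by simp
  have "l (\<Sum>f\<in>G. c f *s cvec f) = (\<Sum>f\<in>G. c f * l (cvec f))" for G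
    using assms(1) by (induction G rule: infinite_finite_induct) (auto simp: linear_form_def l0)
  then show ?thesis using x assms(2) by simp
qed

text \<open>If the new vector \<open>g\<close> lies outside the span of \<open>F\<close>, take a
  form \<open>l\<close> that vanishes on \<open>F\<close> but not at \<open>g\<close>. Move
  \<open>y\<close> along \<open>g\<close> to a point \<open>z\<close> with \<open>l z = 0\<close>,
  separate \<open>z\<close> from \<open>F\<close> by \<open>m\<close>, and subtract the multiple of
  \<open>l\<close> that makes \<open>m\<close> vanish at \<open>g\<close>; the value at
  \<open>y\<close> is then \<open>m z\<close>.\<close>

lemma cspan_separation:
  assumes "finite F" "y \<notin> cspan F"
  shows "\<exists>l. linear_form l \<and> (\<forall>f\<in>F. l (cvec f) = 0) \<and> l y \<noteq> 0"
  using assms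
proof (induction F arbitrary: y rule: finite_induct)
  case empty
  then have "y \<noteq> 0" using cspan_zero by metis
  then obtain i where "y $ i \<noteq> 0" by (auto simp: vec_eq_iff)
  then show ?case
    by (intro exI[of _ "\<lambda>x. x $ i"]) (auto simp: linear_form_def polyf.coord)
next
  case (insert g F)
  have mono: "x \<in> cspan F \<Longrightarrow> x \<in> cspan (insert g F)" for x
    using cspan_mono[of "insert g F" F] insert.hyps by auto
  have g: "cvec g \<in> cspan (insert g F)"
    using cspan_member[of "insert g F"] insert.hyps by auto
  show ?case
  proof (cases "cvec g \<in> cspan F")
    case True
    have "y \<notin> cspan F" using mono insert.prems by blast
    then obtain l where l: "linear_form l" "\<forall>f\<in>F. l (cvec f) = 0" "l y \<noteq> 0"
      using insert.IH by blast
    moreover have "l (cvec g) = 0"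
      using linear_form_vanishes_on_cspan[OF l(1) _ True] l(2) by blast
    ultimately show ?thesis by blast
  next
    case False
    then obtain l where l: "linear_form l" "\<forall>f\<in>F. l (cvec f) = 0" "l (cvec g) \<noteq> 0"
      using insert.IH by blast
    define z where "z = y + (- l y / l (cvec g)) *s cvec g"
    have "z \<notin> cspan F"
    proof
      assume "z \<in> cspan F"
      then have "z - (- l y / l (cvec g)) *s cvec g \<in> cspan (insert g F)"
        by (intro cspan_diff cspan_scale mono g)
      then show False using insert.prems by (simp add: z_def)
    qed
    then obtain m where m: "linear_form m" "\<forall>f\<in>F. m (cvec f) = 0" "m z \<noteq> 0"
      using insert.IH by blast
    define t where "t = (\<lambda>x. m x - (m (cvec g) / l (cvec g)) * l x)"
    have "t \<in> polyf"
      using l(1) m(1) unfolding linear_form_def t_def by (intro polyf_diff polyf_cmult) auto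
    then have "linear_form t"
      using l(1) m(1) unfolding linear_form_def t_def
      by (auto simp: algebra_simps add_divide_distrib)
    moreover have "\<forall>f\<in>insert g F. t (cvec f) = 0"
      using l m by (auto simp: t_def)
    moreover have lin: "m (y + c *s w) = m y + c * m w" for c w
      using m(1) by (simp add: linear_form_def)
    have "t y = m z"
      unfolding t_def z_def lin by simp
    ultimately show ?thesis using m(3) by metis
  qed
qed

text \<open>A weak form of Dickson's lemma: membership in an upward closed set of \<open>\<nat>\<^sup>A\<close> is not
  affected by truncating all coordinates at a sufficiently large bound.\<close>

lemma upward_closed_truncation:
  fixes U :: "('i \<Rightarrow> nat) set"
  assumes "finite A" "\<And>f g. f \<in> U \<Longrightarrow> (\<And>i. i \<in> A \<Longrightarrow> f i \<le> g i) \<Longrightarrow> g \<in> U"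
  shows "\<exists>N. \<forall>f\<in>U. (\<lambda>i. min (f i) N) \<in> U"
  using assms
proof (induction A arbitrary: U rule: finite_induct)
  case empty
  then show ?case by blast
next
  case (insert x A)
  \<comment> \<open>The slice of \<open>U\<close> at the value \<open>j\<close> of the coordinate
    \<open>x\<close>. Slices are upward closed in the other coordinates and increase with
    \<open>j\<close>.\<close>
  define V where "V j = {f. f(x := j) \<in> U}" for j
  have V_up: "g \<in> V j" if "f \<in> V j" "\<And>i. i \<in> A \<Longrightarrow> f i \<le> g i" for f g j
  proof -
    have "f(x := j) \<in> U" using that(1) by (simp add: V_def)
    then have "g(x := j) \<in> U"
      by (rule insert.prems) (use that(2) in auto)
    then show ?thesis by (simp add: V_def)
  qed
  have V_mono: "f \<in> V k" if "f \<in> V j" "j \<le> k" for f j k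
  proof -
    have "f(x := j) \<in> U" using that(1) by (simp add: V_def)
    then have "f(x := k) \<in> U"
      by (rule insert.prems) (use that(2) in auto)
    then show ?thesis by (simp add: V_def)
  qed
  have "\<exists>N. \<forall>f\<in>V j. (\<lambda>i. min (f i) N) \<in> V j" for j
    by (rule insert.IH) (use V_up in blast)
  then obtain N where N: "\<And>j f. f \<in> V j \<Longrightarrow> (\<lambda>i. min (f i) (N j)) \<in> V j"
    by metis
  define W where "W = (\<Union>j. V j)"
  have W_up: "g \<in> W" if "f \<in> W" "\<And>i. i \<in> A \<Longrightarrow> f i \<le> g i" for f g
    using that V_up unfolding W_def by blast
  have "\<exists>M. \<forall>f\<in>W. (\<lambda>i. min (f i) M) \<in> W"
    by (rule insert.IH) (use W_up in blast)
  then obtain M where M: "\<And>f. f \<in> W \<Longrightarrow> (\<lambda>i. min (f i) M) \<in> W" by blast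
  define T where "T = {f \<in> W. \<forall>i. (i \<in> A \<longrightarrow> f i \<in> {..M}) \<and> (i \<notin> A \<longrightarrow> f i = 0)}"
  have "finite T"
    by (rule finite_subset[OF _ finite_set_of_finite_funs[OF insert.hyps(1) finite_atMost[of M], of 0]])
      (auto simp: T_def)
  obtain j where j: "\<And>f. f \<in> T \<Longrightarrow> f \<in> V (j f)"
    unfolding T_def W_def by (metis (no_types, lifting) UN_E mem_Collect_eq)
  \<comment> \<open>The finite set \<open>T\<close> lies in slice \<open>J\<close>, and truncation
    at \<open>M\<close> carries \<open>W\<close> into \<open>T\<close>, so all of \<open>W\<close>
    lies in slice \<open>J\<close>: the slices are constant from \<open>J\<close> on.\<close>
  define J where "J = (\<Sum>f\<in>T. j f)"
  have TJ: "f \<in> V J" if "f \<in> T" for f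
    using V_mono[OF j[OF that]] member_le_sum[OF that _ \<open>finite T\<close>, of j] by (simp add: J_def)
  have WJ: "f \<in> V J" if "f \<in> W" for f
  proof -
    define g where "g = (\<lambda>i. if i \<in> A then min (f i) M else 0)"
    have "g \<in> W" by (rule W_up[OF M[OF that]]) (simp add: g_def)
    then have "g \<in> T" by (simp add: T_def g_def)
    from V_up[OF TJ[OF this]] show ?thesis by (simp add: g_def)
  qed
  \<comment> \<open>Dominates \<open>J\<close> and the truncation bounds of the slices up to
    \<open>J\<close>.\<close>
  define B where "B = J + (\<Sum>i\<le>J. N i)"
  have NB: "N i \<le> B" if "i \<le> J" for i
    using member_le_sum[of i "{..J}" N] that by (simp add: B_def)
  have "(\<lambda>i. min (f i) B) \<in> U" if "f \<in> U" for f
  proof -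
    \<comment> \<open>Since the slices stabilise, lowering \<open>f x\<close> to
      \<open>min (f x) J\<close> does not leave \<open>U\<close>.\<close>
    define k where "k = min (f x) J"
    have "f \<in> V (f x)" using that by (simp add: V_def)
    then have "f \<in> V k"
      using WJ[of f] unfolding k_def W_def by (cases "f x \<le> J") (auto simp: min_def)
    then have "(\<lambda>i. min (f i) (N k))(x := k) \<in> U"
      using N by (simp add: V_def)
    then show ?thesis
    proof (rule insert.prems)
      fix i assume "i \<in> insert x A"
      show "((\<lambda>i. min (f i) (N k))(x := k)) i \<le> min (f i) B"
        using NB[of k] by (auto simp: k_def B_def)
    qed
  qed
  then show ?case by blast
qed

section \<open>The semigroup \<nat>A and its localizations\<close>

lemma vector_ssub_rdistrib: "((a :: 'a :: ring) - b) *s x = a *s x - b *s x"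
  by (simp add: vec_eq_iff left_diff_distrib)

lemma semigroupNA_eq: "semigroupNA A = {x. \<exists>n. x = (\<Sum>a\<in>A. int (n a) *s a)}"
  by (simp add: semigroupNA_def vector_scalar_mult_def)

lemma semigroupNAI: "x = (\<Sum>a\<in>A. int (n a) *s a) \<Longrightarrow> x \<in> semigroupNA A"
  by (auto simp: semigroupNA_eq)

lemma semigroupNA_add: "x \<in> semigroupNA A \<Longrightarrow> y \<in> semigroupNA A \<Longrightarrow> x + y \<in> semigroupNA A"
proof -
  assume "x \<in> semigroupNA A" "y \<in> semigroupNA A"
  then obtain m n where "x = (\<Sum>a\<in>A. int (m a) *s a)" "y = (\<Sum>a\<in>A. int (n a) *s a)"
    by (auto simp: semigroupNA_eq)
  then have "x + y = (\<Sum>a\<in>A. int (m a + n a) *s a)"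
    by (simp add: sum.distrib vector_sadd_rdistrib)
  then show ?thesis by (rule semigroupNAI)
qed

lemma sum_extend:
  fixes k :: "int ^ 'd \<Rightarrow> int"
  assumes "finite A" "F \<subseteq> A"
  shows "(\<Sum>f\<in>F. k f *s f) = (\<Sum>f\<in>A. (if f \<in> F then k f else 0) *s f)"
  using assms by (intro sum.mono_neutral_cong_left) auto

lemma semigroupNA_subset_localized: "semigroupNA A \<subseteq> localized A F"
proof
  fix x assume "x \<in> semigroupNA A"
  then obtain n where "x = (\<Sum>a\<in>A. int (n a) *s a)" by (auto simp: semigroupNA_eq)
  then show "x \<in> localized A F"
    unfolding localized_def mem_Collect_eq by (intro exI[of _ "\<lambda>a. int (n a)"]) simp
qed

lemma localized_add:
  assumes "finite A" "F \<subseteq> A" "x \<in> localized A F"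
  shows "x + (\<Sum>f\<in>F. k f *s f) \<in> localized A F"
proof -
  obtain l where l: "\<forall>a\<in>A - F. l a \<ge> 0" "x = (\<Sum>a\<in>A. l a *s a)"
    using assms(3) by (auto simp: localized_def)
  have "x + (\<Sum>f\<in>F. k f *s f) = (\<Sum>a\<in>A. (l a + (if a \<in> F then k a else 0)) *s a)"
    unfolding l(2) sum_extend[OF assms(1,2)] by (simp add: sum.distrib vector_sadd_rdistrib)
  then show ?thesis
    using l(1) unfolding localized_def mem_Collect_eq
    by (intro exI[of _ "\<lambda>a. l a + (if a \<in> F then k a else 0)"]) auto
qed

text \<open>Adding each \<open>f\<close> in \<open>F\<close> as often as the absolute value of its
  coefficient clears all negative coefficients.\<close>

lemma localized_imp_semigroupNA:
  assumes "finite A" "F \<subseteq> A" "x \<in> localized A F"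
  shows "\<exists>n. x + (\<Sum>f\<in>F. int (n f) *s f) \<in> semigroupNA A"
proof -
  obtain l where l: "\<forall>a\<in>A - F. l a \<ge> 0" "x = (\<Sum>a\<in>A. l a *s a)"
    using assms(3) by (auto simp: localized_def)
  define n where "n = (\<lambda>a. if a \<in> F then nat \<bar>l a\<bar> else 0)"
  have "x + (\<Sum>f\<in>F. int (n f) *s f) = (\<Sum>a\<in>A. (l a + (if a \<in> F then int (n a) else 0)) *s a)"
    unfolding l(2) sum_extend[OF assms(1,2)] by (simp add: sum.distrib vector_sadd_rdistrib)
  also have "\<dots> = (\<Sum>a\<in>A. int (nat (l a + int (n a))) *s a)"
    using l(1) by (intro sum.cong arg_cong2[where f = "(*s)"]) (auto simp: n_def)
  finally show ?thesis by (intro exI[of _ n] semigroupNAI)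
qed

text \<open>If \<open>b\<close> lies in \<nat>A + \<int>F but \<open>b + a\<close> does not, then
  for some \<open>s\<close> in \<open>b + \<nat>F\<close> all of \<open>s + \<nat>F\<close> lies in
  \<nat>A and is moved out of \<nat>A by \<open>a\<close>. The polynomial vanishes there, hence on
  \<open>b + \<complex>F\<close>, which contains \<open>\<alpha>\<close>.\<close>

lemma reach_imp_exponents_subset:
  assumes A: "finite A" and F: "F \<subseteq> A" and "reach A \<alpha> a"
  shows "exponents A F \<alpha> \<subseteq> exponents A F (\<alpha> + cvec a)"
proof
  obtain p where p: "p \<in> polyf" "p \<alpha> \<noteq> 0"
    "\<And>u. u \<in> semigroupNA A \<Longrightarrow> u + a \<notin> semigroupNA A \<Longrightarrow> p (cvec u) = 0"
    using assms(3) by (auto simp: reach_def)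
  fix x assume "x \<in> exponents A F \<alpha>"
  then obtain b where x: "x \<in> cspan F" and b: "b \<in> localized A F" "\<alpha> = x + cvec b"
    by (auto simp: exponents_def)
  have "b + a \<in> localized A F"
  proof (rule ccontr)
    assume not: "b + a \<notin> localized A F"
    obtain m where m: "b + (\<Sum>f\<in>F. int (m f) *s f) \<in> semigroupNA A"
      using localized_imp_semigroupNA[OF A F b(1)] by blast
    define s where "s = b + (\<Sum>f\<in>F. int (m f) *s f)"
    have zero: "p (cvec s + (\<Sum>f\<in>F. of_nat (n f) *s cvec f)) = 0" for n
    proof -
      define u where "u = s + (\<Sum>f\<in>F. int (n f) *s f)"
      have "(\<Sum>f\<in>F. int (n f) *s f) \<in> semigroupNA A"
        unfolding sum_extend[OF A F] semigroupNA_eq mem_Collect_eq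
        by (intro exI[of _ "\<lambda>f. if f \<in> F then n f else 0"] sum.cong) auto
      then have "u \<in> semigroupNA A"
        using m unfolding u_def s_def by (rule semigroupNA_add[rotated])
      moreover have "u + a \<notin> semigroupNA A"
      proof
        assume "u + a \<in> semigroupNA A"
        then have "u + a \<in> localized A F"
          using semigroupNA_subset_localized by blast
        then have "u + a + (\<Sum>f\<in>F. (- int (m f) - int (n f)) *s f) \<in> localized A F"
          by (rule localized_add[OF A F])
        moreover have "u + a + (\<Sum>f\<in>F. (- int (m f) - int (n f)) *s f) = b + a"
          by (simp add: u_def s_def vector_ssub_rdistrib sum_subtractf sum_negf vector_smult_lneg)
        ultimately show False using not by metis
      qed
      ultimately have "p (cvec u) = 0" by (rule p(3))
      then show ?thesis by (simp add: u_def cvec_add cvec_int_comb)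
    qed
    obtain c where c: "x = (\<Sum>f\<in>F. c f *s cvec f)" using x by (auto simp: cspan_def)
    have "p (cvec s + (\<Sum>f\<in>F. (c f - of_nat (m f)) *s cvec f)) = 0"
      by (rule polyf_zero_on_lattice[OF finite_subset[OF F A] p(1) zero])
    moreover have "cvec s + (\<Sum>f\<in>F. (c f - of_nat (m f)) *s cvec f) = \<alpha>"
      by (simp add: b(2) c s_def cvec_add cvec_int_comb vector_ssub_rdistrib sum_subtractf)
    ultimately show False using p(2) by simp
  qed
  then show "x \<in> exponents A F (\<alpha> + cvec a)"
    using x b(2) by (auto simp: exponents_def cvec_add add.assoc intro!: bexI[of _ "b + a"])
qed

text \<open>Truncation writes \<open>{u \<in> \<nat>A. u + a \<notin> \<nat>A}\<close> as a finite union of translates of monoids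
  \<open>\<nat>F\<close>; a product of separating linear forms cuts out their complex spans.\<close>

lemma exponents_subset_imp_reach:
  assumes A: "finite A" and sub: "\<And>F. F \<subseteq> A \<Longrightarrow> exponents A F \<alpha> \<subseteq> exponents A F (\<alpha> + cvec a)"
  shows "reach A \<alpha> a"
proof -
  define s where "s n = (\<Sum>i\<in>A. int (n i) *s i)" for n :: "int ^ 'a \<Rightarrow> nat"
  have s_add: "s (\<lambda>i. m i + n i) = s m + s n" for m n
    by (simp add: s_def sum.distrib vector_sadd_rdistrib)
  have s_cong: "s m = s n" if "\<And>i. i \<in> A \<Longrightarrow> m i = n i" for m n
    using that by (simp add: s_def)
  have s_NA: "s n \<in> semigroupNA A" for n
    by (auto simp: s_def semigroupNA_eq)
  define U where "U = {n. s n + a \<in> semigroupNA A}"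
  have up: "n \<in> U" if "m \<in> U" "\<And>i. i \<in> A \<Longrightarrow> m i \<le> n i" for m n
  proof -
    have "s n = s (\<lambda>i. m i + (n i - m i))"
      using that(2) by (intro s_cong) simp
    then have eq: "s n + a = s m + a + s (\<lambda>i. n i - m i)"
      by (simp add: s_add)
    show ?thesis
      using that(1) unfolding U_def mem_Collect_eq eq by (rule semigroupNA_add[OF _ s_NA])
  qed
  have "\<exists>N. \<forall>n\<in>U. (\<lambda>i. min (n i) N) \<in> U"
    by (rule upward_closed_truncation[OF A]) (rule up)
  then obtain N where N: "\<And>n. n \<in> U \<Longrightarrow> (\<lambda>i. min (n i) N) \<in> U"
    by blast
  define T where "T = {b. b \<notin> U \<and> (\<forall>i. (i \<in> A \<longrightarrow> b i \<in> {..N}) \<and> (i \<notin> A \<longrightarrow> b i = 0))}"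
  have "finite T"
    by (rule finite_subset[OF _ finite_set_of_finite_funs[OF A finite_atMost[of N], of 0]])
      (auto simp: T_def)
  \<comment> \<open>The coordinates that truncation may have lowered. For \<open>b\<close> in
    \<open>T\<close>, raising them arbitrarily never leads into \<open>U\<close>.\<close>
  define G where "G b = {i \<in> A. b i = N}" for b
  have G: "G b \<subseteq> A" for b by (auto simp: G_def)
  have "\<alpha> - cvec (s b) \<notin> cspan (G b)" if b: "b \<in> T" for b
  proof
    assume span: "\<alpha> - cvec (s b) \<in> cspan (G b)"
    have "s b \<in> localized A (G b)" using s_NA semigroupNA_subset_localized by blast
    then have "\<alpha> - cvec (s b) \<in> exponents A (G b) \<alpha>"
      using span by (auto simp: exponents_def intro!: bexI[of _ "s b"])
    then have "\<alpha> - cvec (s b) \<in> exponents A (G b) (\<alpha> + cvec a)"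
      using sub[OF G] by blast
    then obtain c where c: "c \<in> localized A (G b)" "\<alpha> + cvec a = \<alpha> - cvec (s b) + cvec c"
      by (auto simp: exponents_def)
    then have "cvec c = cvec (s b + a)" by (simp add: cvec_add algebra_simps)
    then have "c = s b + a" by simp
    then obtain m where m: "s b + a + (\<Sum>f\<in>G b. int (m f) *s f) \<in> semigroupNA A"
      using localized_imp_semigroupNA[OF A G c(1)] by auto
    define n where "n = (\<lambda>i. b i + (if i \<in> G b then m i else 0))"
    have "(\<Sum>f\<in>G b. int (m f) *s f) = s (\<lambda>i. if i \<in> G b then m i else 0)"
      unfolding sum_extend[OF A G] s_def by (intro sum.cong) auto
    then have "n \<in> U"
      using m by (simp add: U_def n_def s_add algebra_simps)
    \<comment> \<open>Truncating \<open>n\<close> at \<open>N\<close> gives back \<open>b\<close> on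
      \<open>A\<close>, since \<open>n\<close> exceeds \<open>b\<close> only where \<open>b\<close>
      already equals \<open>N\<close>.\<close>
    then have "b \<in> U"
      by (rule up[OF N]) (use b in \<open>auto simp: n_def G_def T_def\<close>)
    then show False using b by (simp add: T_def)
  qed
  then have "\<forall>b\<in>T. \<exists>l. linear_form l \<and> (\<forall>f\<in>G b. l (cvec f) = 0) \<and> l (\<alpha> - cvec (s b)) \<noteq> 0"
    using cspan_separation[OF finite_subset[OF G A]] by blast
  then obtain l where l: "\<And>b. b \<in> T \<Longrightarrow> linear_form (l b)"
    "\<And>b f. b \<in> T \<Longrightarrow> f \<in> G b \<Longrightarrow> l b (cvec f) = 0" "\<And>b. b \<in> T \<Longrightarrow> l b (\<alpha> - cvec (s b)) \<noteq> 0"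
    by metis
  define p where "p = (\<lambda>x. \<Prod>b\<in>T. l b (x - cvec (s b)))"
  have "p \<in> polyf"
    unfolding p_def
  proof (intro polyf_prod)
    fix b assume "b \<in> T"
    then show "(\<lambda>x. l b (x - cvec (s b))) \<in> polyf"
      using polyf_translate[of "l b" "- cvec (s b)"] l(1) by (simp add: linear_form_def)
  qed
  moreover have "p \<alpha> \<noteq> 0"
    using l(3) \<open>finite T\<close> by (simp add: p_def)
  moreover have "p (cvec u) = 0" if u: "u \<in> semigroupNA A" "u + a \<notin> semigroupNA A" for u
  proof -
    obtain n where n: "u = s n" using u(1) by (auto simp: semigroupNA_eq s_def)
    \<comment> \<open>With \<open>b\<close> the truncation of \<open>n\<close>, the point
      \<open>u\<close> lies in \<open>s b + \<nat>(G b)\<close>, where the factor belonging to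
      \<open>b\<close> vanishes.\<close>
    define b where "b = (\<lambda>i. if i \<in> A then min (n i) N else 0)"
    have "n \<notin> U" using u(2) n by (simp add: U_def)
    then have "b \<notin> U" using up[of b n] by (auto simp: b_def)
    then have b: "b \<in> T" by (simp add: T_def b_def)
    have "s n = s (\<lambda>i. b i + (n i - b i))"
      by (intro s_cong) (simp add: b_def)
    then have "cvec u - cvec (s b) = cvec (s (\<lambda>i. n i - b i))"
      by (simp add: n s_add cvec_add)
    also have "s (\<lambda>i. n i - b i) = (\<Sum>i\<in>G b. int (n i - b i) *s i)"
      unfolding s_def using A by (intro sum.mono_neutral_right) (auto simp: G_def b_def min_def split: if_splits)
    finally have "cvec u - cvec (s b) \<in> cspan (G b)"
      using cspan_int_comb by simp
    then have "l b (cvec u - cvec (s b)) = 0"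
      using linear_form_vanishes_on_cspan[OF l(1)[OF b] l(2)[OF b]] by blast
    then show ?thesis
      using b \<open>finite T\<close> by (auto simp: p_def)
  qed
  ultimately show ?thesis unfolding reach_def by blast
qed

lemma reach_iff:
  assumes "finite A"
  shows "reach A \<alpha> a \<longleftrightarrow> (\<forall>F\<subseteq>A. exponents A F \<alpha> \<subseteq> exponents A F (\<alpha> + cvec a))"
  using reach_imp_exponents_subset[OF assms] exponents_subset_imp_reach[OF assms] by metis

subsection \<open>Finiteness\<close>

definition int_span :: "(int ^ 'd) set \<Rightarrow> (int ^ ('d::finite)) set" where
  "int_span F = {x. \<exists>k. x = (\<Sum>f\<in>F. k f *s f)}"

lemma int_spanI: "x = (\<Sum>f\<in>F. k f *s f) \<Longrightarrow> x \<in> int_span F"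
  by (auto simp: int_span_def)

lemma int_span_add: "x \<in> int_span F \<Longrightarrow> y \<in> int_span F \<Longrightarrow> x + y \<in> int_span F"
proof -
  assume "x \<in> int_span F" "y \<in> int_span F"
  then obtain k l where "x = (\<Sum>f\<in>F. k f *s f)" "y = (\<Sum>f\<in>F. l f *s f)"
    by (auto simp: int_span_def)
  then have "x + y = (\<Sum>f\<in>F. (k f + l f) *s f)"
    by (simp add: sum.distrib vector_sadd_rdistrib)
  then show ?thesis by (rule int_spanI)
qed

lemma int_span_scale: "x \<in> int_span F \<Longrightarrow> r *s x \<in> int_span F"
proof -
  assume "x \<in> int_span F"
  then obtain k where "x = (\<Sum>f\<in>F. k f *s f)"
    by (auto simp: int_span_def)
  then have "r *s x = (\<Sum>f\<in>F. (r * k f) *s f)"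
    by (simp add: vec_eq_iff sum_distrib_left mult.assoc)
  then show ?thesis by (rule int_spanI)
qed

lemma int_span_sum: "(\<And>j. j \<in> J \<Longrightarrow> w j \<in> int_span F) \<Longrightarrow> (\<Sum>j\<in>J. w j) \<in> int_span F"
proof (induction J rule: infinite_finite_induct)
  case (insert j J)
  then show ?case by (simp add: int_span_add)
qed (auto intro!: int_spanI[where k = "\<lambda>_. 0"] simp: vec_eq_iff)

lemma cvec_int_span: "w \<in> int_span F \<Longrightarrow> cvec w \<in> cspan F"
  by (auto simp: int_span_def cspan_int_comb)

text \<open>Every finitely generated subgroup of \<complex> lies in a free one. If a new
  \<open>t\<close> satisfies a relation with nonzero coefficient \<open>k t\<close>, dividing the
  basis by \<open>k t\<close> makes \<open>t\<close> an integer combination and loses none of the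
  old elements.\<close>

lemma integer_basis:
  fixes T :: "complex set"
  assumes "finite T"
  shows "\<exists>\<Theta>. finite \<Theta> \<and>
    (\<forall>k :: complex \<Rightarrow> int. (\<Sum>\<theta>\<in>\<Theta>. of_int (k \<theta>) * \<theta>) = 0 \<longrightarrow> (\<forall>\<theta>\<in>\<Theta>. k \<theta> = 0)) \<and>
    (\<forall>t\<in>T. \<exists>k :: complex \<Rightarrow> int. t = (\<Sum>\<theta>\<in>\<Theta>. of_int (k \<theta>) * \<theta>))"
  using assms
proof (induction T rule: finite_induct)
  case empty
  then show ?case by (intro exI[of _ "{}"]) auto
next
  case (insert t T)
  then obtain \<Theta> where \<Theta>: "finite \<Theta>"
    and indep: "\<And>k :: complex \<Rightarrow> int. (\<Sum>\<theta>\<in>\<Theta>. of_int (k \<theta>) * \<theta>) = 0 \<Longrightarrow> \<forall>\<theta>\<in>\<Theta>. k \<theta> = 0"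
    and spans: "\<And>s. s \<in> T \<Longrightarrow> \<exists>k :: complex \<Rightarrow> int. s = (\<Sum>\<theta>\<in>\<Theta>. of_int (k \<theta>) * \<theta>)"
    by metis
  show ?case
  proof (cases "\<forall>k :: complex \<Rightarrow> int. (\<Sum>\<theta>\<in>insert t \<Theta>. of_int (k \<theta>) * \<theta>) = 0 \<longrightarrow> (\<forall>\<theta>\<in>insert t \<Theta>. k \<theta> = 0)")
    case True
    have "\<exists>k :: complex \<Rightarrow> int. s = (\<Sum>\<theta>\<in>insert t \<Theta>. of_int (k \<theta>) * \<theta>)" if s: "s \<in> insert t T" for s
    proof (cases "s = t")
      case True
      have "s = (\<Sum>\<theta>\<in>insert t \<Theta>. of_int (if \<theta> = t then 1 else 0) * \<theta>)"
        using \<Theta> True by (simp add: if_distrib[of of_int] if_distrib[of "\<lambda>x. x * _"] cong: if_cong)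
      then show ?thesis by (rule exI[of _ "\<lambda>\<theta>. if \<theta> = t then 1 else 0"])
    next
      case False
      then obtain k :: "complex \<Rightarrow> int" where "s = (\<Sum>\<theta>\<in>\<Theta>. of_int (k \<theta>) * \<theta>)"
        using spans s by blast
      also have "\<dots> = (\<Sum>\<theta>\<in>insert t \<Theta>. of_int (if \<theta> \<in> \<Theta> then k \<theta> else 0) * \<theta>)"
        using \<Theta> by (intro sum.mono_neutral_cong_left) auto
      finally show ?thesis by (rule exI[of _ "\<lambda>\<theta>. if \<theta> \<in> \<Theta> then k \<theta> else 0"])
    qed
    then show ?thesis using True \<Theta> by (intro exI[of _ "insert t \<Theta>"]) simp
  next
    case dep: False
    then obtain k :: "complex \<Rightarrow> int" where k: "(\<Sum>\<theta>\<in>insert t \<Theta>. of_int (k \<theta>) * \<theta>) = 0"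
      "\<exists>\<theta>\<in>insert t \<Theta>. k \<theta> \<noteq> 0" by blast
    show ?thesis
    proof (cases "t \<in> \<Theta>")
      case True
      then show ?thesis using dep indep by (simp add: insert_absorb)
    next
      case False
      then have rel: "of_int (k t) * t + (\<Sum>\<theta>\<in>\<Theta>. of_int (k \<theta>) * \<theta>) = 0"
        using k(1) \<Theta> by simp
      have kt: "k t \<noteq> 0"
      proof
        assume "k t = 0"
        then have "\<forall>\<theta>\<in>\<Theta>. k \<theta> = 0" using rel by (intro indep) simp
        then show False using k(2) \<open>k t = 0\<close> by auto
      qed
      define r where "r = (of_int (k t) :: complex)"
      have r: "r \<noteq> 0" using kt by (simp add: r_def)
      define \<Theta>' where "\<Theta>' = (\<lambda>\<theta>. \<theta> / r) ` \<Theta>"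
      have reindex: "(\<Sum>\<theta>\<in>\<Theta>'. of_int (l \<theta>) * \<theta>) = (\<Sum>\<theta>\<in>\<Theta>. of_int (l (\<theta> / r)) * \<theta>) / r"
        for l :: "complex \<Rightarrow> int"
        unfolding \<Theta>'_def using r by (subst sum.reindex) (auto simp: inj_on_def sum_divide_distrib)
      have indep': "\<forall>\<theta>\<in>\<Theta>'. l \<theta> = 0" if "(\<Sum>\<theta>\<in>\<Theta>'. of_int (l \<theta>) * \<theta>) = 0" for l :: "complex \<Rightarrow> int"
        using indep[of "\<lambda>\<theta>. l (\<theta> / r)"] that r unfolding reindex by (simp add: \<Theta>'_def)
      have spans': "\<exists>l :: complex \<Rightarrow> int. s = (\<Sum>\<theta>\<in>\<Theta>'. of_int (l \<theta>) * \<theta>)" if s: "s \<in> insert t T" for s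
      proof (cases "s = t")
        case True
        have "(\<Sum>\<theta>\<in>\<Theta>'. of_int (- k (r * \<theta>)) * \<theta>) = - (\<Sum>\<theta>\<in>\<Theta>. of_int (k \<theta>) * \<theta>) / r"
          unfolding reindex using r by (simp add: sum_negf)
        also have "- (\<Sum>\<theta>\<in>\<Theta>. of_int (k \<theta>) * \<theta>) = r * t"
          using rel by (simp add: r_def neg_eq_iff_add_eq_0 add.commute)
        finally have "s = (\<Sum>\<theta>\<in>\<Theta>'. of_int (- k (r * \<theta>)) * \<theta>)" using True r by simp
        then show ?thesis by (rule exI[of _ "\<lambda>\<theta>. - k (r * \<theta>)"])
      next
        case False
        then obtain l :: "complex \<Rightarrow> int" where l: "s = (\<Sum>\<theta>\<in>\<Theta>. of_int (l \<theta>) * \<theta>)"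
          using spans s by blast
        have "(\<Sum>\<theta>\<in>\<Theta>'. of_int (k t * l (r * \<theta>)) * \<theta>) = (\<Sum>\<theta>\<in>\<Theta>. r * (of_int (l \<theta>) * \<theta>)) / r"
          unfolding reindex using r by (simp add: r_def[symmetric] mult.assoc)
        also have "\<dots> = s"
          using r by (simp add: l sum_distrib_left[symmetric])
        finally have "s = (\<Sum>\<theta>\<in>\<Theta>'. of_int (k t * l (r * \<theta>)) * \<theta>)" by simp
        then show ?thesis by (rule exI[of _ "\<lambda>\<theta>. k t * l (r * \<theta>)"])
      qed
      have "finite \<Theta>'" using \<Theta> by (simp add: \<Theta>'_def)
      then show ?thesis
        by (intro exI[of _ \<Theta>'] conjI allI impI) (assumption, erule indep', intro ballI spans')
    qed
  qed
qed

text \<open>Expand the coefficients of \<open>v\<close> with respect to every \<open>F\<close> in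
  one \<int>-independent set \<Theta>; collecting terms gives vectors \<open>w F \<theta>\<close> in
  \<int>F. Independence, used in each coordinate, forces \<open>w F \<theta>\<close> not to depend
  on \<open>F\<close>, so the intersection of the lattices spans the intersection of the complex
  spans.\<close>

lemma Inter_cspan_lattice_comb:
  assumes "finite \<G>" "\<G> \<noteq> {}" "\<And>F. F \<in> \<G> \<Longrightarrow> finite F" "\<And>F. F \<in> \<G> \<Longrightarrow> v \<in> cspan F"
  shows "\<exists>\<Theta> w. finite \<Theta> \<and> v = (\<Sum>\<theta>\<in>\<Theta>. \<theta> *s cvec (w \<theta>)) \<and> (\<forall>\<theta>\<in>\<Theta>. \<forall>F\<in>\<G>. w \<theta> \<in> int_span F)"
proof -
  have "\<forall>F\<in>\<G>. \<exists>c. v = (\<Sum>f\<in>F. c f *s cvec f)"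
    using assms(4) by (auto simp: cspan_def)
  then obtain c where c: "\<And>F. F \<in> \<G> \<Longrightarrow> v = (\<Sum>f\<in>F. c F f *s cvec f)" by metis
  define T where "T = (\<Union>F\<in>\<G>. c F ` F)"
  have "finite T" using assms(1,3) by (auto simp: T_def)
  then obtain \<Theta> where \<Theta>: "finite \<Theta>"
    and indep: "\<And>k :: complex \<Rightarrow> int. (\<Sum>\<theta>\<in>\<Theta>. of_int (k \<theta>) * \<theta>) = 0 \<Longrightarrow> \<forall>\<theta>\<in>\<Theta>. k \<theta> = 0"
    and spans: "\<And>s. s \<in> T \<Longrightarrow> \<exists>k :: complex \<Rightarrow> int. s = (\<Sum>\<theta>\<in>\<Theta>. of_int (k \<theta>) * \<theta>)"
    using integer_basis[of T] by metis
  from spans obtain k :: "complex \<Rightarrow> complex \<Rightarrow> int"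
    where k: "\<And>s. s \<in> T \<Longrightarrow> s = (\<Sum>\<theta>\<in>\<Theta>. of_int (k s \<theta>) * \<theta>)" by metis
  define w where "w F \<theta> = (\<Sum>f\<in>F. k (c F f) \<theta> *s f)" for F \<theta>
  have v: "v $ j = (\<Sum>\<theta>\<in>\<Theta>. of_int (w F \<theta> $ j) * \<theta>)" if F: "F \<in> \<G>" for F j
  proof -
    have "v $ j = (\<Sum>f\<in>F. c F f * of_int (f $ j))"
      by (subst c[OF F]) simp
    also have "\<dots> = (\<Sum>f\<in>F. (\<Sum>\<theta>\<in>\<Theta>. of_int (k (c F f) \<theta>) * \<theta>) * of_int (f $ j))"
    proof (rule sum.cong[OF refl])
      fix f assume "f \<in> F"
      then have "c F f \<in> T" using F by (auto simp: T_def)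
      from k[OF this] show "c F f * of_int (f $ j) = (\<Sum>\<theta>\<in>\<Theta>. of_int (k (c F f) \<theta>) * \<theta>) * of_int (f $ j)"
        by simp
    qed
    also have "\<dots> = (\<Sum>\<theta>\<in>\<Theta>. \<Sum>f\<in>F. of_int (k (c F f) \<theta>) * \<theta> * of_int (f $ j))"
      unfolding sum_distrib_right by (rule sum.swap)
    also have "\<dots> = (\<Sum>\<theta>\<in>\<Theta>. of_int (w F \<theta> $ j) * \<theta>)"
      by (intro sum.cong refl) (simp add: w_def sum_distrib_right sum_distrib_left mult_ac)
    finally show ?thesis .
  qed
  obtain F0 where F0: "F0 \<in> \<G>" using assms(2) by blast
  have "w F0 \<theta> = w F \<theta>" if F: "F \<in> \<G>" and "\<theta> \<in> \<Theta>" for F \<theta>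
  proof -
    have "w F0 \<theta> $ j = w F \<theta> $ j" for j
    proof -
      have "(\<Sum>\<theta>\<in>\<Theta>. of_int (w F0 \<theta> $ j - w F \<theta> $ j) * \<theta>) = 0"
        using v[OF F0, of j] v[OF F, of j] by (simp add: left_diff_distrib sum_subtractf)
      from indep[OF this] show ?thesis using \<open>\<theta> \<in> \<Theta>\<close> by auto
    qed
    then show ?thesis by (simp add: vec_eq_iff)
  qed
  moreover have "w F \<theta> \<in> int_span F" for F \<theta>
    unfolding w_def by (rule int_spanI) (rule refl)
  ultimately have "\<forall>\<theta>\<in>\<Theta>. \<forall>F\<in>\<G>. w F0 \<theta> \<in> int_span F" by metis
  moreover have "v = (\<Sum>\<theta>\<in>\<Theta>. \<theta> *s cvec (w F0 \<theta>))"
    using v[OF F0] by (simp add: vec_eq_iff mult.commute)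
  ultimately show ?thesis using \<Theta> by blast
qed

text \<open>Here \<open>v\<close> is a complex combination of vectors in the common lattice, along
  which \<open>X\<close> is invariant; vanishing along the lattice extends to its complex
  span.\<close>

lemma polyf_zero_translate:
  assumes \<G>: "finite \<G>" "\<G> \<noteq> {}" "\<And>F. F \<in> \<G> \<Longrightarrow> finite F"
    and v: "\<And>F. F \<in> \<G> \<Longrightarrow> v \<in> cspan F"
    and p: "p \<in> polyf" "\<And>x. x \<in> X \<Longrightarrow> p x = 0"
    and inv: "\<And>x w. x \<in> X \<Longrightarrow> (\<And>F. F \<in> \<G> \<Longrightarrow> w \<in> int_span F) \<Longrightarrow> x + cvec w \<in> X"
    and x: "x \<in> X"
  shows "p (x + v) = 0"
proof -
  obtain \<Theta> w where \<Theta>: "finite \<Theta>" "v = (\<Sum>\<theta>\<in>\<Theta>. \<theta> *s cvec (w \<theta>))"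
    "\<forall>\<theta>\<in>\<Theta>. \<forall>F\<in>\<G>. w \<theta> \<in> int_span F"
    using Inter_cspan_lattice_comb[OF \<G> v] by blast
  have "p (x + (\<Sum>\<theta>\<in>\<Theta>. of_nat (n \<theta>) *s cvec (w \<theta>))) = 0" for n
  proof -
    have "(\<Sum>\<theta>\<in>\<Theta>. int (n \<theta>) *s w \<theta>) \<in> int_span F" if "F \<in> \<G>" for F
      using \<Theta>(3) that by (intro int_span_sum int_span_scale) auto
    then have "p (x + cvec (\<Sum>\<theta>\<in>\<Theta>. int (n \<theta>) *s w \<theta>)) = 0"
      by (intro p(2) inv x)
    then show ?thesis by (simp add: cvec_sum cvec_scale)
  qed
  then show ?thesis
    unfolding \<Theta>(2) by (rule polyf_zero_on_lattice[OF \<Theta>(1) p(1)])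
qed

section \<open>Exponents under translation\<close>

lemma exponents_translate:
  assumes "v \<in> cspan F"
  shows "x \<in> exponents A F (\<beta> + v) \<longleftrightarrow> x - v \<in> exponents A F \<beta>"
proof -
  have "x \<in> cspan F \<longleftrightarrow> x - v \<in> cspan F"
    using cspan_diff[OF _ assms, of x] cspan_add[OF _ assms, of "x - v"] by auto
  moreover have "\<beta> + v = x + cvec b \<longleftrightarrow> \<beta> = x - v + cvec b" for b
    by (auto simp: algebra_simps)
  ultimately show ?thesis unfolding exponents_def by auto
qed

lemma localized_int_span:
  "finite A \<Longrightarrow> F \<subseteq> A \<Longrightarrow> b \<in> localized A F \<Longrightarrow> w \<in> int_span F \<Longrightarrow> b + w \<in> localized A F"
  by (auto simp: int_span_def localized_add)

lemma exponents_lattice_invariant: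
  assumes A: "finite A" "F \<subseteq> A" and w: "w \<in> int_span F"
  shows "exponents A F (\<beta> + cvec w) = exponents A F \<beta>"
proof -
  have sub: "exponents A F \<gamma> \<subseteq> exponents A F (\<gamma> + cvec u)" if "u \<in> int_span F" for \<gamma> u
  proof
    fix x assume "x \<in> exponents A F \<gamma>"
    then obtain b where b: "x \<in> cspan F" "b \<in> localized A F" "\<gamma> = x + cvec b"
      by (auto simp: exponents_def)
    then show "x \<in> exponents A F (\<gamma> + cvec u)"
      using localized_int_span[OF A b(2) that]
      by (auto simp: exponents_def cvec_add add.assoc intro!: bexI[of _ "b + u"])
  qed
  have "- w \<in> int_span F" using int_span_scale[OF w, of "- 1"] by (simp add: vector_smult_lneg)
  from sub[OF this, of "\<beta> + cvec w"] have "exponents A F (\<beta> + cvec w) \<subseteq> exponents A F \<beta>"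
    by (simp add: cvec_minus)
  then show ?thesis using sub[OF w] by blast
qed

section \<open>The annihilator as a vanishing condition\<close>

definition active :: "(int ^ 'd) set \<Rightarrow> complex ^ 'd \<Rightarrow> (int ^ ('d::finite)) set set" where
  "active A \<alpha> = {F. F \<subseteq> A \<and> (\<exists>z. \<alpha> - cvec z \<in> cspan F)}"

lemma active_shift: "active A (\<alpha> + cvec m) = active A \<alpha>"
proof -
  have "active A \<beta> \<subseteq> active A (\<beta> + cvec n)" for \<beta> n
  proof
    fix F assume "F \<in> active A \<beta>"
    then obtain z where "F \<subseteq> A" "\<beta> - cvec z \<in> cspan F" by (auto simp: active_def)
    then show "F \<in> active A (\<beta> + cvec n)"
      by (auto simp: active_def cvec_add intro!: exI[of _ "z + n"])
  qed
  from this[of \<alpha> m] this[of "\<alpha> + cvec m" "- m"] show ?thesis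
    by (auto simp: cvec_minus)
qed

text \<open>Hence an inactive \<open>F\<close> imposes no condition among integer translates of
  \<open>\<alpha>\<close>: both sides of every inclusion are empty.\<close>

lemma exponents_inactive:
  assumes "F \<subseteq> A" "F \<notin> active A \<alpha>"
  shows "exponents A F (\<alpha> + cvec m) = {}"
proof (rule ccontr)
  assume "exponents A F (\<alpha> + cvec m) \<noteq> {}"
  then obtain x b where "x \<in> cspan F" "\<alpha> + cvec m = x + cvec b" by (auto simp: exponents_def)
  then have "\<alpha> - cvec (b - m) \<in> cspan F"
    by (metis add_diff_cancel_right' add_diff_eq cvec_diff diff_diff_eq2)
  then show False using assms by (auto simp: active_def)
qed

text \<open>By \<open>reach_iff\<close> these are the \<open>\<beta>\<close> reached from
  \<open>\<alpha>\<close> whose translate by \<open>a\<close> reaches \<open>\<alpha>\<close> back: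
  the points where the component of degree \<open>a\<close> has to vanish.\<close>

definition matching :: "(int ^ 'd) set \<Rightarrow> complex ^ 'd \<Rightarrow> int ^ 'd \<Rightarrow> (complex ^ ('d::finite)) set" where
  "matching A \<alpha> a = {\<beta>. (\<exists>b. \<beta> = \<alpha> + cvec b) \<and> (\<forall>F\<subseteq>A. exponents A F \<alpha> \<subseteq> exponents A F \<beta> \<and>
     exponents A F (\<beta> + cvec a) \<subseteq> exponents A F \<alpha>)}"

lemma AnnL_eq:
  assumes "finite A"
  shows "AnnL A \<alpha> = op_of ` {p. preserving A p \<and> (\<forall>a. \<forall>\<beta>\<in>matching A \<alpha> a. p a \<beta> = 0)}"
proof -
  have "op_of p \<in> AnnL A \<alpha> \<longleftrightarrow> (\<forall>a. \<forall>\<beta>\<in>matching A \<alpha> a. p a \<beta> = 0)" if "preserving A p" for p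
  proof -
    have cancel: "\<alpha> + cvec (a + b) + cvec (- (a + b)) = \<alpha>" "\<alpha> + cvec b + cvec a = \<alpha> + cvec (a + b)" for a b
      by (simp_all add: cvec_add cvec_minus cvec_diff)
    have "\<alpha> + cvec b \<in> matching A \<alpha> a \<longleftrightarrow> reach A \<alpha> b \<and> reach A (\<alpha> + cvec (a + b)) (- (a + b))" for a b
      unfolding matching_def reach_iff[OF assms] mem_Collect_eq cancel(1)
      unfolding cancel(2) by blast
    moreover have "\<exists>b. \<beta> = \<alpha> + cvec b" if "\<beta> \<in> matching A \<alpha> a" for \<beta> a
      using that by (simp add: matching_def)
    ultimately show ?thesis
      unfolding op_of_in_AnnL_iff[OF that] by blast
  qed
  moreover have "AnnL A \<alpha> \<subseteq> op_of ` {p. preserving A p}"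
    by (auto simp: AnnL_def DRA_iff)
  ultimately show ?thesis by auto
qed

lemma matching_lattice_invariant:
  assumes A: "finite A" and \<beta>: "\<beta> \<in> matching A \<alpha> a"
    and w: "\<And>F. F \<in> active A \<alpha> \<Longrightarrow> w \<in> int_span F"
  shows "\<beta> + cvec w \<in> matching A \<alpha> a"
proof -
  obtain b where b: "\<beta> = \<alpha> + cvec b" using \<beta> by (auto simp: matching_def)
  have "exponents A F \<alpha> \<subseteq> exponents A F (\<beta> + cvec w) \<and>
      exponents A F (\<beta> + cvec w + cvec a) \<subseteq> exponents A F \<alpha>" if F: "F \<subseteq> A" for F
  proof (cases "F \<in> active A \<alpha>")
    case True
    have "exponents A F (\<beta> + cvec w) = exponents A F \<beta>"
      by (rule exponents_lattice_invariant[OF A F w[OF True]])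
    moreover have "exponents A F (\<beta> + cvec w + cvec a) = exponents A F (\<beta> + cvec a)"
      using exponents_lattice_invariant[OF A F w[OF True], of "\<beta> + cvec a"] by (simp add: add_ac)
    ultimately show ?thesis using \<beta> F by (auto simp: matching_def)
  next
    case False
    then show ?thesis
      using exponents_inactive[OF F False, of 0] exponents_inactive[OF F False, of "b + w + a"]
      by (simp add: b cvec_add add_ac)
  qed
  then show ?thesis
    unfolding matching_def using b by (auto simp: cvec_add add_ac intro!: exI[of _ "b + w"])
qed

text \<open>For active \<open>F\<close> all the exponent sets involved are shifted alike by
  \<open>v\<close>; for the other \<open>F\<close> they are empty.\<close>

lemma matching_translate:
  assumes \<beta>: "\<beta> \<in> matching A \<alpha> a" and act: "active A (\<alpha> + v) = active A \<alpha>"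
    and v: "\<And>F. F \<in> active A \<alpha> \<Longrightarrow> v \<in> cspan F"
  shows "\<beta> + v \<in> matching A (\<alpha> + v) a"
proof -
  obtain b where b: "\<beta> = \<alpha> + cvec b" using \<beta> by (auto simp: matching_def)
  have "exponents A F (\<alpha> + v) \<subseteq> exponents A F (\<beta> + v) \<and>
      exponents A F (\<beta> + v + cvec a) \<subseteq> exponents A F (\<alpha> + v)" if F: "F \<subseteq> A" for F
  proof (cases "F \<in> active A \<alpha>")
    case True
    have "exponents A F \<alpha> \<subseteq> exponents A F \<beta>" "exponents A F (\<beta> + cvec a) \<subseteq> exponents A F \<alpha>"
      using \<beta> F by (auto simp: matching_def)
    moreover have "exponents A F (\<beta> + v + cvec a) = exponents A F (\<beta> + cvec a + v)"
      by (simp add: add_ac)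
    ultimately show ?thesis
      by (simp only: subset_iff exponents_translate[OF v[OF True]]) blast
  next
    case False
    then have "F \<notin> active A (\<alpha> + v)" using act by simp
    from exponents_inactive[OF F this, of 0] exponents_inactive[OF F this, of "b + a"]
    show ?thesis by (simp add: b cvec_add add_ac)
  qed
  then show ?thesis
    unfolding matching_def using b by (auto simp: add_ac intro!: exI[of _ b])
qed

text \<open>Translation by \<open>v\<close> maps the matching set of \<open>\<alpha>\<close> into
  that of \<open>\<alpha> + v\<close>, and by lattice invariance a polynomial vanishing on the
  latter also vanishes on its translate by \<open>- v\<close>. The other inclusion is the same
  statement for \<open>\<alpha> + v\<close> and \<open>- v\<close>.\<close>

lemma AnnL_translate:
  assumes A: "finite A" and act: "active A (\<alpha> + v) = active A \<alpha>" "active A \<alpha> \<noteq> {}"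
    and v: "\<And>F. F \<in> active A \<alpha> \<Longrightarrow> v \<in> cspan F"
  shows "AnnL A (\<alpha> + v) = AnnL A \<alpha>"
proof -
  have sub: "AnnL A (\<gamma> + u) \<subseteq> AnnL A \<gamma>"
    if act: "active A (\<gamma> + u) = active A \<gamma>" "active A \<gamma> \<noteq> {}"
      and u: "\<And>F. F \<in> active A \<gamma> \<Longrightarrow> u \<in> cspan F" for \<gamma> u
  proof -
    have fin: "finite (active A \<gamma>)" "\<And>F. F \<in> active A \<gamma> \<Longrightarrow> finite F"
      using A finite_subset[of _ A] by (auto simp: active_def intro: finite_subset[of _ "Pow A"])
    have "p a \<beta> = 0"
      if p: "preserving A p" "\<forall>a. \<forall>\<beta>\<in>matching A (\<gamma> + u) a. p a \<beta> = 0" and \<beta>: "\<beta> \<in> matching A \<gamma> a"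
      for p a \<beta>
    proof -
      have "p a (\<beta> + u + - u) = 0"
      proof (rule polyf_zero_translate[OF fin(1) act(2) fin(2)])
        show "- u \<in> cspan F" if "F \<in> active A \<gamma>" for F
          using u[OF that] by (rule cspan_minus)
        show "p a \<in> polyf" using p(1) by (simp add: preserving_def symbol_family_def)
        show "p a x = 0" if "x \<in> matching A (\<gamma> + u) a" for x
          using p(2) that by blast
        show "x + cvec w \<in> matching A (\<gamma> + u) a"
          if "x \<in> matching A (\<gamma> + u) a" "\<And>F. F \<in> active A \<gamma> \<Longrightarrow> w \<in> int_span F" for x w
          using matching_lattice_invariant[OF A that(1)] that(2) act(1) by simp
        show "\<beta> + u \<in> matching A (\<gamma> + u) a"
          by (rule matching_translate[OF \<beta> act(1) u])
      qed
      then show ?thesis by simp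
    qed
    then show ?thesis unfolding AnnL_eq[OF A] by blast
  qed
  have "AnnL A (\<alpha> + v + - v) \<subseteq> AnnL A (\<alpha> + v)"
    by (rule sub) (use act v in \<open>auto intro: cspan_minus\<close>)
  then show ?thesis using sub[OF act v] by auto
qed

text \<open>\<open>matching\<close> sees \<open>\<alpha>\<close> only through its coset modulo
  \<int>^d and its exponent sets.\<close>

lemma AnnL_cong_exponents:
  assumes A: "finite A" and eq: "\<And>F. F \<subseteq> A \<Longrightarrow> exponents A F (\<alpha> + cvec m) = exponents A F \<alpha>"
  shows "AnnL A (\<alpha> + cvec m) = AnnL A \<alpha>"
proof -
  have "(\<exists>b. \<beta> = \<alpha> + cvec m + cvec b) \<longleftrightarrow> (\<exists>b. \<beta> = \<alpha> + cvec b)" for \<beta>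
  proof
    show "\<exists>b. \<beta> = \<alpha> + cvec b" if "\<exists>b. \<beta> = \<alpha> + cvec m + cvec b"
      using that by (metis add.assoc cvec_add)
    show "\<exists>b. \<beta> = \<alpha> + cvec m + cvec b" if "\<exists>b. \<beta> = \<alpha> + cvec b"
    proof -
      obtain b where "\<beta> = \<alpha> + cvec b" using \<open>\<exists>b. \<beta> = \<alpha> + cvec b\<close> ..
      then have "\<beta> = \<alpha> + cvec m + cvec (b - m)" by (simp add: cvec_diff)
      then show ?thesis ..
    qed
  qed
  then have "matching A (\<alpha> + cvec m) a = matching A \<alpha> a" for a
    unfolding matching_def using eq by simp
  then show ?thesis by (simp add: AnnL_eq[OF A])
qed

section \<open>Finite data determining the annihilator\<close>

definition coeff_box :: "(int ^ ('d::finite)) set \<Rightarrow> (int ^ 'd) set" where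
  "coeff_box A = {z. \<forall>j. \<bar>z $ j\<bar> \<le> 1 + (\<Sum>a\<in>A. \<Sum>i\<in>UNIV. \<bar>a $ i\<bar>)}"

lemma finite_coeff_box: "finite (coeff_box A)"
proof -
  define B where "B = {- (1 + (\<Sum>a\<in>A. \<Sum>i\<in>UNIV. \<bar>a $ i\<bar>)) .. 1 + (\<Sum>a\<in>A. \<Sum>i\<in>UNIV. \<bar>a $ i\<bar>)}"
  have "finite {f :: 'a \<Rightarrow> int. \<forall>x. (x \<in> UNIV \<longrightarrow> f x \<in> B) \<and> (x \<notin> UNIV \<longrightarrow> f x = 0)}"
    by (rule finite_set_of_finite_funs) (auto simp: B_def)
  then have "finite (vec_lambda ` {f :: 'a \<Rightarrow> int. \<forall>x. (x \<in> UNIV \<longrightarrow> f x \<in> B) \<and> (x \<notin> UNIV \<longrightarrow> f x = 0)})"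
    by (rule finite_imageI)
  moreover have "coeff_box A \<subseteq> vec_lambda ` {f :: 'a \<Rightarrow> int. \<forall>x. (x \<in> UNIV \<longrightarrow> f x \<in> B) \<and> (x \<notin> UNIV \<longrightarrow> f x = 0)}"
  proof
    fix z assume "z \<in> coeff_box A"
    then have "\<bar>z $ j\<bar> \<le> 1 + (\<Sum>a\<in>A. \<Sum>i\<in>UNIV. \<bar>a $ i\<bar>)" for j
      by (simp add: coeff_box_def)
    then have "z $ j \<in> B" for j
      unfolding B_def atLeastAtMost_iff abs_le_iff by (meson minus_le_iff)
    then show "z \<in> vec_lambda ` {f :: 'a \<Rightarrow> int. \<forall>x. (x \<in> UNIV \<longrightarrow> f x \<in> B) \<and> (x \<notin> UNIV \<longrightarrow> f x = 0)}"
      by (intro image_eqI[of _ _ "vec_nth z"]) auto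
  qed
  ultimately show ?thesis by (rule finite_subset[rotated])
qed

text \<open>Taking real parts and subtracting the floors of the coefficients makes a lattice point of
  \<open>\<alpha> + cspan F\<close> bounded modulo \<open>\<int>F\<close>.\<close>

lemma box_representative:
  assumes A: "finite A" "F \<subseteq> A" and z: "\<alpha> - cvec z \<in> cspan F" and \<alpha>: "\<And>j. \<bar>Re (\<alpha> $ j)\<bar> \<le> 1"
  shows "\<exists>w\<in>int_span F. z + w \<in> coeff_box A"
proof -
  obtain c where c: "\<alpha> - cvec z = (\<Sum>f\<in>F. c f *s cvec f)" using z by (auto simp: cspan_def)
  define w where "w = (\<Sum>f\<in>F. \<lfloor>Re (c f)\<rfloor> *s f)"
  have "\<bar>(z + w) $ j\<bar> \<le> 1 + (\<Sum>a\<in>A. \<Sum>i\<in>UNIV. \<bar>a $ i\<bar>)" for j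
  proof -
    have "Re ((\<alpha> - cvec z) $ j) = (\<Sum>f\<in>F. Re (c f) * of_int (f $ j))"
      unfolding c by simp
    then have "real_of_int ((z + w) $ j) = Re (\<alpha> $ j) - (\<Sum>f\<in>F. frac (Re (c f)) * of_int (f $ j))"
      by (simp add: w_def frac_def left_diff_distrib sum_subtractf)
    then have "\<bar>real_of_int ((z + w) $ j)\<bar> \<le> \<bar>Re (\<alpha> $ j)\<bar> + \<bar>\<Sum>f\<in>F. frac (Re (c f)) * of_int (f $ j)\<bar>"
      by linarith
    \<comment> \<open>In the bound of \<open>coeff_box\<close> the 1 covers the real part of
      \<open>\<alpha>\<close>, and the double sum covers a combination with coefficients in [0,
      1).\<close>
    also have "\<dots> \<le> 1 + (\<Sum>f\<in>F. \<bar>frac (Re (c f)) * of_int (f $ j)\<bar>)"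
      by (intro add_mono \<alpha> sum_abs)
    also have "(\<Sum>f\<in>F. \<bar>frac (Re (c f)) * of_int (f $ j)\<bar>) \<le> (\<Sum>f\<in>F. \<bar>of_int (f $ j)\<bar>)"
    proof (rule sum_mono)
      fix f
      have "\<bar>frac (Re (c f))\<bar> \<le> 1"
        using frac_ge_0[of "Re (c f)"] frac_lt_1[of "Re (c f)"] by linarith
      then show "\<bar>frac (Re (c f)) * of_int (f $ j)\<bar> \<le> \<bar>of_int (f $ j)\<bar>"
        by (simp add: abs_mult mult_left_le_one_le)
    qed
    also have "(\<Sum>f\<in>F. \<bar>of_int (f $ j)\<bar>) \<le> (\<Sum>f\<in>A. \<bar>of_int (f $ j)\<bar> :: real)"
      using A by (intro sum_mono2) auto
    also have "\<dots> \<le> (\<Sum>f\<in>A. \<Sum>i\<in>UNIV. \<bar>of_int (f $ i)\<bar>)"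
      by (intro sum_mono member_le_sum) auto
    finally have "real_of_int \<bar>(z + w) $ j\<bar> \<le> real_of_int (1 + (\<Sum>a\<in>A. \<Sum>i\<in>UNIV. \<bar>a $ i\<bar>))"
      by simp
    then show ?thesis by (simp only: of_int_le_iff)
  qed
  then show ?thesis
    by (intro bexI[of _ w]) (auto simp: coeff_box_def w_def intro: int_spanI)
qed

text \<open>Via \<open>x = c - cvec y\<close>, the set \<open>exponents A F (c + cvec n)\<close>
  corresponds to the integer points \<open>y\<close> of \<complex>F with \<open>n + y\<close> in
  \<nat>A + \<int>F. That set is \<int>F-invariant, so its members in the box decide the
  inclusion.\<close>

lemma exponents_mono_box:
  assumes A: "finite A" "F \<subseteq> A" and c: "c \<in> cspan F"
    and sub: "\<And>y. y \<in> coeff_box A \<Longrightarrow> cvec y \<in> cspan F \<Longrightarrow> n + y \<in> localized A F \<Longrightarrow> m + y \<in> localized A F"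
  shows "exponents A F (c + cvec n) \<subseteq> exponents A F (c + cvec m)"
proof
  fix x assume "x \<in> exponents A F (c + cvec n)"
  then obtain b where x: "x \<in> cspan F" and b: "b \<in> localized A F" "c + cvec n = x + cvec b"
    by (auto simp: exponents_def)
  define y where "y = b - n"
  have cy: "c = x + cvec y" using b(2) by (simp add: y_def cvec_diff algebra_simps)
  then have y: "cvec y \<in> cspan F" using cspan_diff[OF c x] by simp
  then have "0 - cvec y \<in> cspan F" using cspan_minus by simp
  then obtain w where w: "w \<in> int_span F" "y + w \<in> coeff_box A"
    using box_representative[OF A, of 0 y] by auto
  have "n + (y + w) \<in> localized A F"
    using localized_int_span[OF A b(1) w(1)] by (simp add: y_def algebra_simps)
  moreover have "cvec (y + w) \<in> cspan F"
    using cspan_add[OF y cvec_int_span[OF w(1)]] by (simp add: cvec_add)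
  ultimately have "m + (y + w) \<in> localized A F" using sub[OF w(2)] by blast
  moreover have "- w \<in> int_span F"
    using int_span_scale[OF w(1), of "- 1"] by (simp add: vector_smult_lneg)
  ultimately have "m + (y + w) + - w \<in> localized A F"
    using localized_int_span[OF A] by blast
  then have "m + y \<in> localized A F" by (simp add: add.assoc)
  then show "x \<in> exponents A F (c + cvec m)"
    using x cy by (auto simp: exponents_def cvec_add add_ac intro!: bexI[of _ "m + y"])
qed

text \<open>For active \<open>F\<close>, \<open>fst (\<tau> F)\<close> locates the class of
  \<open>\<alpha> - cvec m\<close> modulo \<complex>F by a lattice point of the box, and
  \<open>snd (\<tau> F)\<close> records \<open>exponents A F \<alpha>\<close> by box
  representatives. The default \<open>(0, {})\<close> keeps the number of possible
  \<open>\<tau>\<close> finite.\<close>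

definition has_type :: "(int ^ 'd) set \<Rightarrow> complex ^ ('d::finite) \<Rightarrow> int ^ 'd \<Rightarrow>
    ((int ^ 'd) set \<Rightarrow> (int ^ 'd) \<times> (int ^ 'd) set) \<Rightarrow> bool" where
  "has_type A \<alpha> m \<tau> \<longleftrightarrow> (\<forall>F. if F \<in> active A \<alpha>
     then fst (\<tau> F) \<in> coeff_box A \<and> \<alpha> - cvec m - cvec (fst (\<tau> F)) \<in> cspan F \<and>
       snd (\<tau> F) = {y \<in> coeff_box A. cvec y \<in> cspan F \<and> m + fst (\<tau> F) + y \<in> localized A F}
     else \<tau> F = (0, {}))"

lemma ex_has_type:
  assumes A: "finite A"
  shows "\<exists>m \<tau>. has_type A \<alpha> m \<tau>"
proof -
  \<comment> \<open>Floors leave real parts in [0, 1), within the bound that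
    \<open>box_representative\<close> asks for.\<close>
  define m :: "int ^ 'a" where "m = (\<chi> j. \<lfloor>Re (\<alpha> $ j)\<rfloor>)"
  have "\<exists>z\<in>coeff_box A. \<alpha> - cvec m - cvec z \<in> cspan F" if F: "F \<in> active A \<alpha>" for F
  proof -
    obtain z where z: "F \<subseteq> A" "\<alpha> - cvec z \<in> cspan F" using F by (auto simp: active_def)
    have "\<exists>w\<in>int_span F. z - m + w \<in> coeff_box A"
    proof (rule box_representative[OF A z(1)])
      show "\<alpha> - cvec m - cvec (z - m) \<in> cspan F" using z(2) by (simp add: cvec_diff)
      show "\<bar>Re ((\<alpha> - cvec m) $ j)\<bar> \<le> 1" for j
        unfolding m_def by (simp add: abs_le_iff) linarith
    qed
    then obtain w where w: "w \<in> int_span F" "z - m + w \<in> coeff_box A" by blast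
    have "\<alpha> - cvec z - cvec w \<in> cspan F"
      by (rule cspan_diff[OF z(2) cvec_int_span[OF w(1)]])
    then show ?thesis
      using w(2) by (intro bexI[of _ "z - m + w"]) (auto simp: cvec_add cvec_diff algebra_simps)
  qed
  then obtain z where z: "\<And>F. F \<in> active A \<alpha> \<Longrightarrow> z F \<in> coeff_box A \<and> \<alpha> - cvec m - cvec (z F) \<in> cspan F"
    by metis
  have "has_type A \<alpha> m (\<lambda>F. if F \<in> active A \<alpha>
      then (z F, {y \<in> coeff_box A. cvec y \<in> cspan F \<and> m + z F + y \<in> localized A F}) else (0, {}))"
    using z by (simp add: has_type_def)
  then show ?thesis by blast
qed

text \<open>The comparison passes through \<open>\<gamma>\<close>, the translate of
  \<open>\<alpha>\<close> by \<open>m' - m\<close>. The common \<open>fst (\<tau> F)\<close> cancels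
  in \<open>\<alpha>' - \<gamma>\<close>, which therefore lies in every active \<complex>F; the
  common \<open>snd (\<tau> F)\<close> gives \<open>\<gamma>\<close> and \<open>\<alpha>\<close> the
  same exponents.\<close>

lemma AnnL_eq_of_type:
  assumes A: "finite A" and type: "has_type A \<alpha> m \<tau>" "has_type A \<alpha>' m' \<tau>"
    and act: "active A \<alpha>' = active A \<alpha>" "active A \<alpha> \<noteq> {}"
  shows "AnnL A \<alpha>' = AnnL A \<alpha>"
proof -
  define \<gamma> where "\<gamma> = \<alpha> + cvec (m' - m)"
  define v where "v = \<alpha>' - \<gamma>"
  have t: "\<alpha> - cvec m - cvec (fst (\<tau> F)) \<in> cspan F" "\<alpha>' - cvec m' - cvec (fst (\<tau> F)) \<in> cspan F"
    "snd (\<tau> F) = {y \<in> coeff_box A. cvec y \<in> cspan F \<and> m + fst (\<tau> F) + y \<in> localized A F}"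
    "snd (\<tau> F) = {y \<in> coeff_box A. cvec y \<in> cspan F \<and> m' + fst (\<tau> F) + y \<in> localized A F}"
    if F: "F \<in> active A \<alpha>" for F
    using type(1)[unfolded has_type_def, rule_format, of F]
      type(2)[unfolded has_type_def, rule_format, of F] F act(1) by simp_all
  have act\<gamma>: "active A \<gamma> = active A \<alpha>" by (simp add: \<gamma>_def active_shift)
  have "v \<in> cspan F" if "F \<in> active A \<gamma>" for F
  proof -
    have "(\<alpha>' - cvec m' - cvec (fst (\<tau> F))) - (\<alpha> - cvec m - cvec (fst (\<tau> F))) \<in> cspan F"
      using that unfolding act\<gamma> by (intro cspan_diff[OF t(2) t(1)])
    then show ?thesis by (simp add: v_def \<gamma>_def cvec_diff algebra_simps)
  qed
  then have "AnnL A (\<gamma> + v) = AnnL A \<gamma>"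
    by (intro AnnL_translate[OF A]) (use act act\<gamma> in \<open>auto simp: v_def\<close>)
  moreover have "AnnL A \<gamma> = AnnL A \<alpha>"
    unfolding \<gamma>_def
  proof (rule AnnL_cong_exponents[OF A])
    fix F assume F: "F \<subseteq> A"
    show "exponents A F (\<alpha> + cvec (m' - m)) = exponents A F \<alpha>"
    proof (cases "F \<in> active A \<alpha>")
      case False
      then show ?thesis
        using exponents_inactive[OF F False, of 0] exponents_inactive[OF F False] by simp
    next
      case True
      define c where "c = \<alpha> - cvec m - cvec (fst (\<tau> F))"
      have c: "c \<in> cspan F" using t(1)[OF True] by (simp add: c_def)
      have "exponents A F (c + cvec (m + fst (\<tau> F))) \<subseteq> exponents A F (c + cvec (m' + fst (\<tau> F)))"
        using t(3,4)[OF True] by (intro exponents_mono_box[OF A F c]) blast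
      moreover have "exponents A F (c + cvec (m' + fst (\<tau> F))) \<subseteq> exponents A F (c + cvec (m + fst (\<tau> F)))"
        using t(3,4)[OF True] by (intro exponents_mono_box[OF A F c]) blast
      moreover have "c + cvec (m + fst (\<tau> F)) = \<alpha>" "c + cvec (m' + fst (\<tau> F)) = \<alpha> + cvec (m' - m)"
        by (simp_all add: c_def cvec_add cvec_diff)
      ultimately show ?thesis by simp
    qed
  qed
  ultimately show ?thesis by (simp add: v_def)
qed

text \<open>Makes \<open>A\<close> itself active for every \<open>\<alpha>\<close>, so that the
  family of active subsets is never empty.\<close>

lemma cspan_generating:
  assumes "group_generated A = UNIV"
  shows "x \<in> cspan A"
proof -
  have int: "cvec u \<in> cspan A" for u
  proof -
    obtain k where "u = (\<Sum>a\<in>A. (\<chi> j. k a * a $ j))"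
      using assms by (auto simp: group_generated_def)
    then have "u = (\<Sum>a\<in>A. k a *s a)" by (simp add: vector_scalar_mult_def)
    then show ?thesis using cspan_int_comb by metis
  qed
  have "(\<Sum>j\<in>J. (x $ j) *s cvec (axis j 1)) \<in> cspan A" for J
    by (induction J rule: infinite_finite_induct) (auto intro: cspan_zero cspan_add cspan_scale int)
  moreover have "cvec (axis j 1) = axis j 1" for j :: 'a
    by (simp add: vec_eq_iff axis_def)
  ultimately have "(\<Sum>j\<in>UNIV. (x $ j) *s axis j 1) \<in> cspan A"
    by (simp only:)
  then show ?thesis by (simp only: vec_eq_sum_axis)
qed

theorem theorem7p6:
  fixes A :: "(int ^ ('d::finite)) set"
  assumes "finite A"
    and "group_generated A = UNIV"
  shows "finite {AnnL A \<alpha> | \<alpha>. True}"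
proof -
  obtain m \<tau> where type: "\<And>\<alpha>. has_type A \<alpha> (m \<alpha>) (\<tau> \<alpha>)"
    using ex_has_type[OF assms(1)] by metis
  \<comment> \<open>The annihilator depends only on this pair, which takes finitely many
    values.\<close>
  define key where "key \<alpha> = (active A \<alpha>, \<tau> \<alpha>)" for \<alpha>
  \<comment> \<open>Fixing the value outside \<open>Pow A\<close> makes this a finite set of
    functions; 0 is the first component at inactive subsets of \<open>A\<close>.\<close>
  define \<T> where "\<T> = {t. \<forall>F. (F \<in> Pow A \<longrightarrow> t F \<in> insert 0 (coeff_box A) \<times> Pow (coeff_box A)) \<and> (F \<notin> Pow A \<longrightarrow> t F = (0, {}))}"
  have "finite \<T>"
    unfolding \<T>_def by (rule finite_set_of_finite_funs) (auto simp: assms(1) finite_coeff_box)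
  have "\<tau> \<alpha> \<in> \<T>" for \<alpha>
  proof -
    have "\<tau> \<alpha> F \<in> insert 0 (coeff_box A) \<times> Pow (coeff_box A)" for F
      using type[of \<alpha>] unfolding has_type_def
      by (cases "\<tau> \<alpha> F"; cases "F \<in> active A \<alpha>") (force dest!: spec[of _ F])+
    moreover have "\<tau> \<alpha> F = (0, {})" if "F \<notin> Pow A" for F
      using type[of \<alpha>] that unfolding has_type_def active_def by auto
    ultimately show ?thesis by (auto simp: \<T>_def)
  qed
  then have "range key \<subseteq> Pow (Pow A) \<times> \<T>"
    by (auto simp: key_def active_def)
  then have fin: "finite (range key)"
    using assms(1) \<open>finite \<T>\<close> by (auto intro: finite_subset[of _ "Pow (Pow A) \<times> \<T>"])
  have "active A \<alpha> \<noteq> {}" for \<alpha>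
    using cspan_generating[OF assms(2)] by (auto simp: active_def)
  then have "AnnL A \<beta> = AnnL A \<alpha>" if "key \<beta> = key \<alpha>" for \<alpha> \<beta>
    using that AnnL_eq_of_type[OF assms(1) type[of \<alpha>], of \<beta> "m \<beta>"] type[of \<beta>] by (auto simp: key_def)
  then have "AnnL A \<alpha> = (AnnL A \<circ> inv key) (key \<alpha>)" for \<alpha>
    by (metis comp_apply f_inv_into_f rangeI)
  then have "{AnnL A \<alpha> | \<alpha>. True} \<subseteq> (AnnL A \<circ> inv key) ` range key"
    by blast
  then show ?thesis
    using fin finite_surj by blast
qed

end
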